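(* Let $J\in\mathbb N^*$ and let $\sigma_\pm^j=\sigma_\pm^j(z_0)>0$, $1\le j\le J$, be the local classical densities at $z_0$ (see context). Let $$G_{z_0}(w)=\prod_{j=1}^Jg^j(w),\qquad \widetilde G_{z_0}(w)=\det\big(g^{i,j}(w)\big)_{1\le i,j\le J},\qquad w\in\mathbb C,$$ where $g^1,\dots,g^J$ are independent Gaussian analytic functions with covariance kernels $\exp(\sigma_+^ju\bar v)$, and $g^{i,j}$, $1\le i,j\le J$, are independent Gaussian analytic functions with covariance kernels $\exp\big(\frac12(\sigma_+^i+\sigma_-^j)u\bar v\big)$. Then the zero point processes $\mathcal Z_{G_{z_0}}$ and $\mathcal Z_{\widetilde G_{z_0}}$ are invariant in distribution under translations and rotations of $\mathbb C$: for all $\alpha,\beta\in\mathbb C$ with $|\alpha|=1$, setting $\tau(w)=\alpha w+\beta$, $$\mathcal Z_{G_{z_0}}\stackrel{d}{=}\mathcal Z_{G_{z_0}\circ\tau},\qquad \mathcal Z_{\widetilde G_{z_0}}\stackrel{d}{=}\mathcal Z_{\widetilde G_{z_0}\circ\tau}.$$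
   Context: In the source, $p_0:\mathbb R^2\to\mathbb C$ is the principal symbol of a nonselfadjoint semiclassical operator, $p_0^{-1}(z_0)=\{\rho_\pm^j:1\le j\le J\}$ with $\pm\{\mathrm{Re}\,p_0,\mathrm{Im}\,p_0\}(\rho_\pm^j)<0$, and $\sigma_\pm^j(z_0)=1/|\{\mathrm{Re}\,p_0,\mathrm{Im}\,p_0\}(\rho_\pm^j)|$; only the positive numbers $\sigma_\pm^j$ enter the statement. (In the case of $G_{z_0}$ the symbol is assumed symmetric under $\xi\mapsto-\xi$, so $\sigma_+^j=\sigma_-^j$.) A Gaussian analytic function with covariance kernel $K$ is a random entire function with centred circular complex Gaussian finite-dimensional distributions, $\mathbb E[g(u)\overline{g(v)}]=K(u,\bar v)$. For a random analytic function $G\not\equiv0$ (a.s.), $\mathcal Z_G=\sum_{w\in G^{-1}(0)}\delta_w$ (zeros counted with multiplicity), a random point measure; $\stackrel{d}{=}$ denotes equality in distribution. *)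

theory Defs
  imports
    "HOL-Probability.Probability"
    "HOL-Complex_Analysis.Complex_Analysis"
    "Jordan_Normal_Form.Determinant"
begin

section \<open>Gaussian analytic functions\<close>

text \<open>The normalisation is \<open>E |Z|\<^sup>2 = 1\<close>.\<close>

definition std_complex_normal :: "complex measure" where
  "std_complex_normal =
     density lborel (\<lambda>z. ennreal (exp (- (cmod z)\<^sup>2) / pi))"

text \<open>
  A finite family \<open>(X i)\<close>, \<open>i \<in> I\<close>, is a centred circular complex Gaussian vector if its joint law
  is the law of \<open>A Z\<close> for some matrix \<open>A\<close> and some vector \<open>Z\<close> of independent standard complex
  normal variables. Degenerate covariances are thus allowed.
\<close>

definition circular_gaussian_vector :: "'a measure \<Rightarrow> 'i set \<Rightarrow> ('i \<Rightarrow> 'a \<Rightarrow> complex) \<Rightarrow> bool" where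
  "circular_gaussian_vector M I X \<longleftrightarrow>
     (\<forall>i\<in>I. X i \<in> borel_measurable M) \<and>
     (\<exists>(m::nat) (A :: 'i \<Rightarrow> nat \<Rightarrow> complex).
        distr M (PiM I (\<lambda>_. borel)) (\<lambda>\<omega>. \<lambda>i\<in>I. X i \<omega>) =
        distr (PiM {..<m} (\<lambda>_. std_complex_normal)) (PiM I (\<lambda>_. borel))
          (\<lambda>\<zeta>. \<lambda>i\<in>I. \<Sum>k<m. A i k * \<zeta> k))"

text \<open>
  The kernel is used as \<open>K u (cnj v)\<close>, so the kernel written \<open>exp (s u (cnj v))\<close> in \<open>(u, v)\<close>
  is \<open>K = (\<lambda>x y. exp (s * x * y))\<close>.
\<close>

definition gaussian_analytic_function ::
  "'a measure \<Rightarrow> (complex \<Rightarrow> complex \<Rightarrow> complex) \<Rightarrow> ('a \<Rightarrow> complex \<Rightarrow> complex) \<Rightarrow> bool" where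
  "gaussian_analytic_function M K g \<longleftrightarrow>
     (\<forall>\<omega>\<in>space M. g \<omega> holomorphic_on UNIV) \<and>
     (\<forall>S. finite S \<longrightarrow> circular_gaussian_vector M S (\<lambda>z \<omega>. g \<omega> z)) \<and>
     (\<forall>u v. (\<integral>\<omega>. g \<omega> u * cnj (g \<omega> v) \<partial>M) = K u (cnj v))"

text \<open>
  Independence of random entire functions is independence of the sigma-algebras generated by all
  their point evaluations; on entire functions the product sigma-algebra is the Borel
  sigma-algebra of locally uniform convergence.
\<close>

definition indep_random_functions ::
  "'a measure \<Rightarrow> 'i set \<Rightarrow> ('i \<Rightarrow> 'a \<Rightarrow> complex \<Rightarrow> complex) \<Rightarrow> bool" where
  "indep_random_functions M I g \<longleftrightarrow>
     prob_space.indep_vars M (\<lambda>_. PiM UNIV (\<lambda>_. borel)) g I"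


section \<open>Zero point processes\<close>

text \<open>
  The measure \<open>\<Sum> mult(w) \<delta>\<^sub>w\<close> over the zeros \<open>w\<close> of an entire function \<open>f\<close>. The order of
  a zero is meaningless for \<open>f = 0\<close>, and there we take the zero measure; this is irrelevant for
  random functions that are almost surely not identically zero.
\<close>

definition zero_measure :: "(complex \<Rightarrow> complex) \<Rightarrow> complex measure" where
  "zero_measure f =
     (if \<forall>w. f w = 0 then null_measure borel
      else distr (density (count_space {w. f w = 0}) (\<lambda>w. of_nat (nat (zorder f w)))) borel (\<lambda>w. w))"

text \<open>
  Locally finite Borel measures on the plane, with the sigma-algebra generated by the evaluations
  on bounded Borel sets, i.e. the Borel sigma-algebra of the vague topology.
\<close>

definition locally_finite_measures :: "complex measure set" where
  "locally_finite_measures =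
     {\<mu>. sets \<mu> = sets borel \<and> (\<forall>A\<in>sets borel. bounded A \<longrightarrow> emeasure \<mu> A < \<infinity>)}"

definition random_measure_algebra :: "complex measure measure" where
  "random_measure_algebra =
     (SUP A \<in> {A \<in> sets borel. bounded A}.
        vimage_algebra locally_finite_measures (\<lambda>\<mu>. emeasure \<mu> A) borel)"

text \<open>Measurability is part of equality in distribution, since \<^const>\<open>distr\<close> is only
  meaningful for measurable maps.\<close>

definition eq_in_distribution ::
  "'a measure \<Rightarrow> 'b measure \<Rightarrow> ('a \<Rightarrow> 'b) \<Rightarrow> ('a \<Rightarrow> 'b) \<Rightarrow> bool" where
  "eq_in_distribution M N X Y \<longleftrightarrow>
     X \<in> measurable M N \<and> Y \<in> measurable M N \<and> distr M N X = distr M N Y"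

definition zero_process :: "('a \<Rightarrow> complex \<Rightarrow> complex) \<Rightarrow> 'a \<Rightarrow> complex measure" where
  "zero_process F \<omega> = zero_measure (F \<omega>)"


section \<open>The two limiting random functions\<close>

definition product_field ::
  "nat \<Rightarrow> (nat \<Rightarrow> 'a \<Rightarrow> complex \<Rightarrow> complex) \<Rightarrow> 'a \<Rightarrow> complex \<Rightarrow> complex" where
  "product_field J g \<omega> w = (\<Prod>j = 1..J. g j \<omega> w)"

text \<open>Library matrices are indexed from \<open>0\<close>, hence the shift.\<close>

definition det_field ::
  "nat \<Rightarrow> (nat \<Rightarrow> nat \<Rightarrow> 'a \<Rightarrow> complex \<Rightarrow> complex) \<Rightarrow> 'a \<Rightarrow> complex \<Rightarrow> complex" where
  "det_field J h \<omega> w = Determinant.det (Matrix.mat J J (\<lambda>(i, j). h (Suc i) (Suc j) \<omega> w))"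

end

theory Submission
  imports Defs
begin

text \<open>
  A Gaussian analytic function \<open>g\<close> with kernel \<open>exp (s u (cnj v))\<close> has the same law as
  \<open>g (\<alpha> w + \<beta>) exp (- s (\<alpha> (cnj \<beta>) w + \<bar>\<beta>\<bar>\<^sup>2 / 2))\<close>, since both have the same covariance. By
  independence this can be done for all factors, respectively all matrix entries, simultaneously.
  The exponential factors pull out of the product, and also out of the determinant because \<open>s\<close>
  is there a sum of a row and a column parameter; so the field composed with the motion is, up to
  a nowhere vanishing factor, equal in law to the field itself.

  It remains that the zero measure is a measurable function of the point evaluations of an entire
  function. For compact \<open>K\<close>, having at least \<open>k\<close> zeros in \<open>K\<close> means being divisible by
  \<open>k\<close> linear factors with roots in \<open>K\<close>, a condition closed under uniform convergence on a large
  disc; closed conditions are measurable by separability, and a Dynkin argument reaches all bounded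
  Borel sets.
\<close>

section \<open>Measurability of the zero measure\<close>

text \<open>Equal covariances do not directly compare laws: \<open>circular_gaussian_vector\<close>
  presents a vector as the image of some number of standard variables under some matrix, and neither
  is unique. The characteristic function, however, depends on the covariance alone, so the law is
  recovered by a multivariate uniqueness theorem, derived here from the one-dimensional theorem of
  Levy. The exponential factor comes from expanding
  \<open>(\<alpha> * u + \<beta>) * cnj (\<alpha> * v + \<beta>)\<close>: for |\<alpha>| = 1 this is
  \<open>u * cnj v\<close> plus a function of \<open>u\<close> plus the conjugate of the same
  function of \<open>v\<close>, so the excess is cancelled by a multiplier of \<open>g\<close>
  itself. Its exponent is linear in \<open>s\<close>, hence exponents of several factors add up. The
  obstacle on the measurable side is that events of the product sigma-algebra see only countably
  many evaluations, while zeros are not visible in countably many values of an arbitrary function.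
  This forces the restriction to entire functions and the use of countable dense sets. A random
  field may also vanish identically at some outcomes, so the zero function has to be carried
  through.\<close>

definition multiplicity_at :: "(complex \<Rightarrow> complex) \<Rightarrow> complex \<Rightarrow> nat" where
  "multiplicity_at f w = nat (zorder f w)"

section \<open>Multiplicities of zeros of entire functions\<close>

lemma entire_eventually_nonzero:
  assumes "f holomorphic_on UNIV" "f a \<noteq> (0::complex)"
  shows "eventually (\<lambda>z. f z \<noteq> 0) (at w)"
  using non_zero_neighbour_alt[OF assms(1) open_UNIV connected_UNIV UNIV_I UNIV_I assms(2), of w]
  by simp

lemma entire_analytic: "f holomorphic_on UNIV \<Longrightarrow> f analytic_on A"
  using analytic_on_open analytic_on_subset open_UNIV by blast

lemma multiplicity_at_nonzero:
  assumes "f holomorphic_on UNIV" "f w \<noteq> 0"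
  shows "multiplicity_at f w = 0"
  using zorder_eq_0I[OF entire_analytic[OF assms(1)] assms(2)]
  by (simp add: multiplicity_at_def)

text \<open>Makes the \<open>nat\<close> in \<open>multiplicity_at\<close> lossless, so that
  additivity of \<open>zorder\<close> carries over to multiplicities.\<close>

lemma zorder_entire_nonneg:
  assumes "f holomorphic_on UNIV" "f a \<noteq> 0"
  shows "zorder f w \<ge> 0"
  using zorder_exist_zero[OF assms(1) open_UNIV connected_UNIV UNIV_I, of w] assms(2)
  by (metis UNIV_I less_imp_le order.refl)

lemma multiplicity_at_mult:
  assumes "f holomorphic_on UNIV" "g holomorphic_on UNIV" "f a \<noteq> 0" "g b \<noteq> 0"
  shows "multiplicity_at (\<lambda>w. f w * g w) z = multiplicity_at f z + multiplicity_at g z"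
proof -
  \<comment> \<open>\<open>f\<close> and \<open>g\<close> may be known to be nonzero at different
    points; isolation of zeros makes both nonzero near \<open>z\<close>.\<close>
  have "eventually (\<lambda>w. f w * g w \<noteq> 0) (at z)"
    using entire_eventually_nonzero[OF assms(1,3), of z] entire_eventually_nonzero[OF assms(2,4), of z]
    by eventually_elim simp
  then show ?thesis
    using zorder_times_analytic[of f z g] assms entire_analytic
      zorder_entire_nonneg[OF assms(1,3), of z] zorder_entire_nonneg[OF assms(2,4), of z]
    by (simp add: multiplicity_at_def nat_add_distrib)
qed

lemma multiplicity_at_linear: "multiplicity_at (\<lambda>w. w - z) w = (if w = z then 1 else 0)"
proof (cases "w = z")
  case True
  have "zorder (\<lambda>w. w - z) z = 1"
    by (rule zorder_eqI[of UNIV _ "\<lambda>_. 1"]) auto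
  then show ?thesis using True by (simp add: multiplicity_at_def)
qed (auto intro!: multiplicity_at_nonzero holomorphic_intros)

section \<open>The zero measure as a sum of multiplicities\<close>

lemma sets_zero_measure [simp]: "sets (zero_measure f) = sets borel"
  by (simp add: zero_measure_def)

lemma emeasure_zero_measure:
  assumes "f holomorphic_on UNIV" "f a \<noteq> 0" "A \<in> sets borel"
  shows "emeasure (zero_measure f) A =
    (\<integral>\<^sup>+w. of_nat (multiplicity_at f w) * indicator A w \<partial>count_space UNIV)"
proof -
  have "emeasure (zero_measure f) A =
     (\<integral>\<^sup>+w. of_nat (nat (zorder f w)) * indicator A w \<partial>count_space {w. f w = 0})"
    using assms(2,3)
    by (auto simp: zero_measure_def emeasure_distr emeasure_density intro!: nn_integral_cong split: split_indicator)
  also have "\<dots> = (\<integral>\<^sup>+w. of_nat (multiplicity_at f w) * indicator A w \<partial>count_space UNIV)"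
    unfolding multiplicity_at_def[symmetric]
    by (subst nn_integral_count_space_indicator)
      (auto intro!: nn_integral_cong simp: indicator_def multiplicity_at_nonzero[OF assms(1)])
  finally show ?thesis .
qed

lemma emeasure_zero_measure_zero:
  "(\<And>w. f w = 0) \<Longrightarrow> emeasure (zero_measure f) A = 0"
  by (simp add: zero_measure_def)

lemma finite_entire_zeros:
  assumes "f holomorphic_on UNIV" "f a \<noteq> 0" "compact K"
  shows "finite {z\<in>K. f z = (0::complex)}"
proof (cases "f constant_on UNIV")
  case True
  then obtain c where "\<And>x. f x = c" unfolding constant_on_def by auto
  then show ?thesis using assms(2) by simp
next
  case False
  then show ?thesis
    using holomorphic_compact_finite_zeros[OF assms(1) open_UNIV connected_UNIV assms(3)] by simp
qed

lemma emeasure_zero_measure_finite: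
  assumes "f holomorphic_on UNIV" "bounded A" "A \<in> sets borel"
  obtains n :: nat where "emeasure (zero_measure f) A = of_nat n"
proof (cases "\<forall>w. f w = 0")
  case True
  then show ?thesis using that[of 0] emeasure_zero_measure_zero[of f A] by simp
next
  case False
  then obtain a where a: "f a \<noteq> 0" by auto
  define Z where "Z = {z\<in>A. f z = 0}"
  have "Z \<subseteq> {z\<in>closure A. f z = 0}" unfolding Z_def using closure_subset by auto
  then have fin: "finite Z"
    using finite_entire_zeros[OF assms(1) a, of "closure A"] assms(2) by (auto intro: finite_subset)
  have "emeasure (zero_measure f) A =
      (\<integral>\<^sup>+w. of_nat (multiplicity_at f w) * indicator A w \<partial>count_space UNIV)"
    by (rule emeasure_zero_measure[OF assms(1) a assms(3)])
  also have "\<dots> = (\<Sum>w\<in>Z. of_nat (multiplicity_at f w) * indicator A w)"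
    by (rule nn_integral_count_space'[OF fin])
      (auto simp: Z_def indicator_def multiplicity_at_nonzero[OF assms(1)])
  also have "\<dots> = of_nat (\<Sum>w\<in>Z. multiplicity_at f w)"
    unfolding of_nat_sum by (intro sum.cong refl) (auto simp: Z_def)
  finally show ?thesis by (rule that)
qed

lemma zero_measure_locally_finite:
  assumes "f holomorphic_on UNIV"
  shows "zero_measure f \<in> locally_finite_measures"
  unfolding locally_finite_measures_def
  by (auto elim: emeasure_zero_measure_finite[OF assms] simp: of_nat_less_top)

lemma emeasure_zero_measure_linear_factor:
  assumes "h holomorphic_on UNIV" "h a \<noteq> 0" "A \<in> sets borel"
  shows "emeasure (zero_measure (\<lambda>w. (w - z) * h w)) A = emeasure (zero_measure h) A + indicator A z"
proof -
  obtain b where b: "b \<noteq> z" "h b \<noteq> 0"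
  proof (cases "a = z")
    case True
    \<comment> \<open>The product vanishes at \<open>z\<close>, so if the known nonzero point of
      \<open>h\<close> is \<open>z\<close> itself, a nearby point has to replace it.\<close>
    have "eventually (\<lambda>w. h w \<noteq> 0 \<and> w \<noteq> z) (at z)"
      using entire_eventually_nonzero[OF assms(1,2), of z] by (auto simp: eventually_at_filter)
    then show ?thesis using eventually_happens[of _ "at z"] that by auto
  qed (use assms that in auto)
  have "emeasure (zero_measure (\<lambda>w. (w - z) * h w)) A =
      (\<integral>\<^sup>+w. of_nat (multiplicity_at (\<lambda>w. (w - z) * h w) w) * indicator A w \<partial>count_space UNIV)"
    using b by (intro emeasure_zero_measure[of _ b]) (auto intro!: holomorphic_intros assms)
  also have "\<dots> = (\<integral>\<^sup>+w. of_nat (multiplicity_at h w) * indicator A w + indicator A z * indicator {z} w \<partial>count_space UNIV)"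
  proof (intro nn_integral_cong)
    fix w
    have "multiplicity_at (\<lambda>w. (w - z) * h w) w = (if w = z then 1 else 0) + multiplicity_at h w"
      using multiplicity_at_mult[of "\<lambda>w. w - z" h b b w] b assms(1)
      by (simp add: multiplicity_at_linear holomorphic_on_diff)
    then show "of_nat (multiplicity_at (\<lambda>w. (w - z) * h w) w) * indicator A w =
        of_nat (multiplicity_at h w) * indicator A w + (indicator A z * indicator {z} w :: ennreal)"
      by (auto simp: indicator_def)
  qed
  also have "\<dots> = emeasure (zero_measure h) A + indicator A z"
    by (subst nn_integral_add) (auto simp: nn_integral_cmult emeasure_zero_measure[OF assms])
  finally show ?thesis .
qed

section \<open>Counting zeros by linear factors\<close>

lemma entire_factor:
  assumes "f holomorphic_on UNIV" "f z = (0::complex)"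
  obtains h where "h holomorphic_on UNIV" "f = (\<lambda>w. (w - z) * h w)"
proof
  let ?h = "\<lambda>w. if w = z then deriv f z else f w / (w - z)"
  \<comment> \<open>The singularity of the quotient at \<open>z\<close> is removable, with the
    derivative as its value. This covers \<open>f\<close> identically zero, which may arise as a
    uniform limit.\<close>
  show "?h holomorphic_on UNIV"
    by (rule pole_theorem_open_0[OF assms(1) open_UNIV, of z]) (use assms in auto)
  show "f = (\<lambda>w. (w - z) * ?h w)"
    using assms(2) by auto
qed

text \<open>With multiplicity; the zero function satisfies this for every \<open>k\<close> if \<open>K\<close> is nonempty.\<close>

primrec has_zeros_in :: "complex set \<Rightarrow> nat \<Rightarrow> (complex \<Rightarrow> complex) \<Rightarrow> bool" where
  "has_zeros_in K 0 f \<longleftrightarrow> f holomorphic_on UNIV"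
| "has_zeros_in K (Suc k) f \<longleftrightarrow> (\<exists>z\<in>K. \<exists>h. has_zeros_in K k h \<and> f = (\<lambda>w. (w - z) * h w))"

lemma has_zeros_in_entire: "has_zeros_in K k f \<Longrightarrow> f holomorphic_on UNIV"
  by (induction k arbitrary: f) (auto intro!: holomorphic_intros)

text \<open>Each root in \<open>K\<close> that is divided out lowers the count on \<open>K\<close>
  by exactly one. The point \<open>a\<close> remains a witness of nonvanishing for every quotient,
  since \<open>f a\<close> is a multiple of \<open>h a\<close>.\<close>

lemma has_zeros_in_iff:
  assumes "f holomorphic_on UNIV" "f a \<noteq> 0" "K \<in> sets borel"
  shows "has_zeros_in K k f \<longleftrightarrow> of_nat k \<le> emeasure (zero_measure f) K"
  using assms(1,2)
proof (induction k arbitrary: f a)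
  case (Suc k)
  have *: "of_nat (Suc k) \<le> emeasure (zero_measure h) K + 1 \<longleftrightarrow> of_nat k \<le> emeasure (zero_measure h) K" for h
    by (simp add: add.commute[of _ 1] ennreal_add_left_cancel_le)
  show ?case
  proof
    assume "has_zeros_in K (Suc k) f"
    then obtain z h where z: "z \<in> K" "has_zeros_in K k h" "f = (\<lambda>w. (w - z) * h w)" by auto
    then have h: "h holomorphic_on UNIV" "h a \<noteq> 0" using Suc.prems has_zeros_in_entire by auto
    show "of_nat (Suc k) \<le> emeasure (zero_measure f) K"
      using emeasure_zero_measure_linear_factor[OF h assms(3), of z] Suc.IH[OF h] z *[of h] by simp
  next
    assume ge: "of_nat (Suc k) \<le> emeasure (zero_measure f) K"
    have "\<exists>z\<in>K. f z = 0"
    proof (rule ccontr)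
      assume "\<not> (\<exists>z\<in>K. f z = 0)"
      then have "emeasure (zero_measure f) K = (\<integral>\<^sup>+(w::complex). 0 \<partial>count_space UNIV)"
        unfolding emeasure_zero_measure[OF Suc.prems assms(3)]
        by (intro nn_integral_cong) (auto simp: indicator_def multiplicity_at_nonzero[OF Suc.prems(1)])
      then show False using ge by simp
    qed
    then obtain z where z: "z \<in> K" "f z = 0" by auto
    obtain h where h: "h holomorphic_on UNIV" "f = (\<lambda>w. (w - z) * h w)"
      using entire_factor[OF Suc.prems(1) z(2)] .
    then have a: "h a \<noteq> 0" using Suc.prems by auto
    have "has_zeros_in K k h"
      using emeasure_zero_measure_linear_factor[OF h(1) a assms(3), of z] Suc.IH[OF h(1) a] z(1) *[of h]
        ge h(2) by simp
    then show "has_zeros_in K (Suc k) f" using z h by auto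
  qed
qed simp


text \<open>
  One linear factor is divided out at a time; the quotients converge uniformly on the boundary of
  the disc, hence inside by the maximum principle.
\<close>

lemma has_zeros_in_uniform_limit:
  assumes K: "compact K" "\<And>z. z \<in> K \<Longrightarrow> cmod z + 1 \<le> R"
    and F: "\<And>n. has_zeros_in K k (F n)" "uniform_limit (cball 0 R) F f sequentially"
    and f: "f holomorphic_on UNIV"
  shows "has_zeros_in K k f"
  using F f
proof (induction k arbitrary: F f)
  case (Suc k)
  have "\<forall>n. \<exists>z h. z \<in> K \<and> has_zeros_in K k h \<and> F n = (\<lambda>w. (w - z) * h w)"
    using Suc.prems(1) unfolding has_zeros_in.simps by blast
  then obtain z h where zh: "\<And>n. z n \<in> K" "\<And>n. has_zeros_in K k (h n)"
      "\<And>n. F n = (\<lambda>w. (w - z n) * h n w)"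
    by metis
  \<comment> \<open>The roots split off from the \<open>F n\<close> need not converge; compactness
    provides a subsequence whose limit stays in \<open>K\<close>.\<close>
  obtain l r where l: "l \<in> K" and r: "strict_mono (r :: nat \<Rightarrow> nat)" "(z \<circ> r) \<longlonglongrightarrow> l"
    using compact_imp_seq_compact[OF K(1)] zh(1) unfolding seq_compact_def by metis
  have lim: "uniform_limit (cball 0 R) (\<lambda>n. F (r n)) f sequentially"
    using filterlim_compose[OF Suc.prems(2) filterlim_subseq[OF r(1)]] by (simp add: o_def)
  have in_ball: "w \<in> K \<Longrightarrow> w \<in> cball 0 R" for w using K(2)[of w] by simp
  have cont: "continuous_on UNIV f" by (rule holomorphic_on_imp_continuous_on[OF Suc.prems(3)])
  \<comment> \<open>The points of evaluation move, so pointwise convergence would not do. As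
    \<open>F (r n)\<close> vanishes at \<open>z (r n)\<close>, the limit is a root of
    \<open>f\<close>.\<close>
  have "(\<lambda>n. F (r n) (z (r n)) - f (z (r n))) \<longlonglongrightarrow> 0"
  proof (rule tendstoI)
    fix e :: real assume "e > 0"
    then have "eventually (\<lambda>n. \<forall>x\<in>cball 0 R. dist (F (r n) x) (f x) < e) sequentially"
      by (rule uniform_limitD[OF lim])
    then show "eventually (\<lambda>n. dist (F (r n) (z (r n)) - f (z (r n))) 0 < e) sequentially"
      by eventually_elim (use zh(1) in_ball in \<open>auto simp: dist_norm\<close>)
  qed
  moreover have "(\<lambda>n. f (z (r n))) \<longlonglongrightarrow> f l"
    using r(2) cont isCont_tendsto_compose[of l f "\<lambda>n. z (r n)"]
    by (auto simp: o_def continuous_on_eq_continuous_at)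
  ultimately have "(\<lambda>n. F (r n) (z (r n)) - f (z (r n)) + f (z (r n))) \<longlonglongrightarrow> 0 + f l"
    by (rule tendsto_add)
  then have "f l = 0" by (simp add: zh(3) LIMSEQ_const_iff)
  then obtain g where g: "g holomorphic_on UNIV" "f = (\<lambda>w. (w - l) * g w)"
    using entire_factor[OF Suc.prems(3)] by blast
  have h: "h n holomorphic_on UNIV" for n by (rule has_zeros_in_entire[OF zh(2)])
  have gcont: "continuous_on A g" for A
    using holomorphic_on_imp_continuous_on[OF g(1)] continuous_on_subset by blast
  obtain B where B: "\<And>w. w \<in> cball 0 R \<Longrightarrow> cmod (g w) \<le> B" "B > 0"
    using compact_imp_bounded[OF compact_continuous_image[OF gcont compact_cball]]
    unfolding bounded_pos by (metis imageI)
  have "uniform_limit (cball 0 R) (\<lambda>n. h (r n)) g sequentially"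
  proof (rule uniform_limitI)
    fix e :: real assume e: "e > 0"
    have "eventually (\<lambda>n. \<forall>x\<in>cball 0 R. dist (F (r n) x) (f x) < e / 4) sequentially"
      by (rule uniform_limitD[OF lim]) (use e in auto)
    moreover have "eventually (\<lambda>n. dist (z (r n)) l < e / (4 * B)) sequentially"
      using tendstoD[OF r(2), of "e / (4 * B)"] e B(2) by (simp add: o_def)
    ultimately show "eventually (\<lambda>n. \<forall>x\<in>cball 0 R. dist (h (r n) x) (g x) < e) sequentially"
    proof eventually_elim
      case (elim n)
      let ?z = "z (r n)"
      have bound: "cmod (h (r n) w - g w) \<le> e / 2" if "w \<in> frontier (cball 0 R)" for w
      proof -
        have w: "cmod w = R" using that by simp
        \<comment> \<open>The margin 1 in the choice of \<open>R\<close> keeps the boundary circle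
          at distance at least 1 from every root, so dividing by the linear factor cannot enlarge
          the error.\<close>
        have "1 \<le> cmod (w - ?z)"
          using K(2)[OF zh(1)[of "r n"]] w norm_triangle_ineq2[of w ?z] by linarith
        then have "cmod (h (r n) w - g w) * 1 \<le> cmod (h (r n) w - g w) * cmod (w - ?z)"
          by (intro mult_left_mono) auto
        \<comment> \<open>The error splits into that of \<open>F (r n)\<close> and that of the
          displaced root; the thresholds \<open>e / 4\<close> and \<open>e / (4 * B)\<close> make
          each at most \<open>e / 4\<close>.\<close>
        also have "\<dots> = cmod ((F (r n) w - f w) + g w * (?z - l))"
          unfolding norm_mult[symmetric] by (simp add: zh(3) g(2) algebra_simps)
        also have "\<dots> \<le> cmod (F (r n) w - f w) + cmod (g w) * cmod (?z - l)"
          by (metis norm_mult norm_triangle_ineq)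
        also have "\<dots> \<le> e / 4 + B * (e / (4 * B))"
          using elim w B(1)[of w] B(2) by (intro add_mono mult_mono) (auto simp: dist_norm less_imp_le)
        finally show ?thesis using B(2) by simp
      qed
      have "cmod (h (r n) w - g w) \<le> e / 2" if "w \<in> cball 0 R" for w
      proof (rule maximum_modulus_frontier[of "\<lambda>w. h (r n) w - g w" "cball 0 R"])
        have hol: "(\<lambda>w. h (r n) w - g w) holomorphic_on A" for A
          using holomorphic_on_diff[OF h g(1)] by (rule holomorphic_on_subset) simp
        show "(\<lambda>w. h (r n) w - g w) holomorphic_on interior (cball 0 R)" by (rule hol)
        show "continuous_on (closure (cball 0 R)) (\<lambda>w. h (r n) w - g w)"
          by (rule holomorphic_on_imp_continuous_on[OF hol])
      qed (use bound that in auto)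
      then show ?case using e by (fastforce simp: dist_norm)
    qed
  qed
  then have "has_zeros_in K k g"
    by (rule Suc.IH[OF zh(2) _ g(1)])
  then show ?case using l g(2) by auto
qed simp

section \<open>Separability, and dependence on countably many point evaluations\<close>

lemma countable_dense_entire:
  fixes R :: real
  obtains Q where "countable Q" "\<And>q. q \<in> Q \<Longrightarrow> q holomorphic_on UNIV"
    "\<And>f e. f holomorphic_on UNIV \<Longrightarrow> e > 0 \<Longrightarrow> \<exists>q\<in>Q. \<forall>w\<in>cball 0 R. cmod (f w - q w) \<le> e"
proof -
  obtain C :: "complex set" where C: "countable C" "UNIV \<subseteq> closure C"
    by (rule separable[of UNIV])
  \<comment> \<open>Polynomials given by their coefficient lists; restricting the coefficients to
    \<open>C\<close> leaves countably many.\<close>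
  define P where "P = (\<lambda>cs w. \<Sum>i<length cs. cs ! i * w ^ i :: complex)"
  have 1: "countable (P ` lists C)" using C(1) by (intro countable_image countable_lists)
  have 2: "q holomorphic_on UNIV" if "q \<in> P ` lists C" for q
    using that by (auto simp: P_def intro!: holomorphic_intros)
  have 3: "\<exists>q\<in>P ` lists C. \<forall>w\<in>cball 0 R. cmod (f w - q w) \<le> e"
    if f: "f holomorphic_on UNIV" and e: "e > 0" for f e
  proof -
    define a where "a n = (deriv ^^ n) f 0 / fact n" for n
    have sums: "(\<lambda>n. a n * w ^ n) sums f w" for w
      using holomorphic_power_series[of f 0 "cmod w + 1" w] holomorphic_on_subset[OF f]
      by (simp add: a_def)
    have f_eq: "f = (\<lambda>w. \<Sum>n. a n * w ^ n)"
      using sums_unique[OF sums] by auto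
    \<comment> \<open>The Taylor series converges at the point |R| + 1, so its radius exceeds
      \<open>R\<close> and convergence is uniform on the closed disc.\<close>
    have "norm (of_real (\<bar>R\<bar> + 1) :: complex) \<le> conv_radius a"
      by (rule conv_radius_geI[OF sums_summable[OF sums]])
    then have "R < conv_radius a"
      by (rule less_le_trans[rotated]) simp
    then have "uniform_limit (cball 0 R) (\<lambda>n x. \<Sum>i<n. a i * (x - 0) ^ i) (\<lambda>x. suminf (\<lambda>i. a i * (x - 0) ^ i)) sequentially"
      by (rule powser_uniform_limit)
    then have "uniform_limit (cball 0 R) (\<lambda>n x. \<Sum>i<n. a i * x ^ i) f sequentially"
      by (subst f_eq) simp
    from uniform_limitD[OF this, of "e / 2"] e obtain n where
      "\<forall>x\<in>cball 0 R. dist (\<Sum>i<n. a i * x ^ i) (f x) < e / 2"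
      unfolding eventually_sequentially by auto
    then have n: "\<And>x. x \<in> cball 0 R \<Longrightarrow> cmod ((\<Sum>i<n. a i * x ^ i) - f x) < e / 2"
      by (simp add: dist_norm)
    \<comment> \<open>The tolerance for each coefficient: \<open>d\<close> times the sum bounds the
      total perturbation on the disc, and the choice makes it at most \<open>e / 2\<close>. The last
      1 keeps the denominator positive even for an empty sum.\<close>
    define d where "d = e / (2 * (\<Sum>i<n. \<bar>R\<bar> ^ i + 1) + 1)"
    have S: "0 \<le> (\<Sum>i<n. \<bar>R\<bar> ^ i + 1)" by (intro sum_nonneg) auto
    then have d: "d > 0" unfolding d_def using e by (intro divide_pos_pos) auto
    have "\<exists>c\<in>C. cmod (c - x) < d" for x
      using C(2) closure_approachable[of x C] d by (auto simp: dist_norm)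
    then obtain c where c: "\<And>x. c x \<in> C" "\<And>x. cmod (c x - x) < d" by metis
    define q where "q = P (map (\<lambda>i. c (a i)) [0..<n])"
    have q: "q w = (\<Sum>i<n. c (a i) * w ^ i)" for w by (simp add: q_def P_def)
    have "cmod (f w - q w) \<le> e" if w: "w \<in> cball 0 R" for w
    proof -
      have "cmod (q w - (\<Sum>i<n. a i * w ^ i)) = cmod (\<Sum>i<n. (c (a i) - a i) * w ^ i)"
        by (simp add: q sum_subtractf left_diff_distrib)
      also have "\<dots> \<le> (\<Sum>i<n. d * (\<bar>R\<bar> ^ i + 1))"
        using w c(2)[THEN less_imp_le] d
        by (intro sum_norm_le) (auto simp: norm_mult norm_power intro!: mult_mono add_increasing2 power_mono)
      also have "\<dots> = d * (\<Sum>i<n. \<bar>R\<bar> ^ i + 1)" by (simp add: sum_distrib_left)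
      also have "\<dots> \<le> e / 2"
        using S e by (simp add: d_def field_simps)
      finally have "cmod (q w - (\<Sum>i<n. a i * w ^ i)) \<le> e / 2" .
      then show ?thesis
        using n[OF w] norm_triangle_ineq4[of "(\<Sum>i<n. a i * w ^ i) - q w" "(\<Sum>i<n. a i * w ^ i) - f w"]
        by (simp add: norm_minus_commute)
    qed
    moreover have "q \<in> P ` lists C" unfolding q_def using c(1) by (intro imageI) auto
    ultimately show ?thesis by blast
  qed
  show thesis by (rule that[OF 1 2 3])
qed

text \<open>A trace sigma-algebra is taken because the set of entire functions does not itself
  belong to the product sigma-algebra: no countable set of evaluations decides whether an arbitrary
  function is entire.\<close>

definition entire_functions :: "(complex \<Rightarrow> complex) measure" where
  "entire_functions = restrict_space (PiM UNIV (\<lambda>_. borel)) {f. f holomorphic_on UNIV}"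

lemma space_entire_functions: "space entire_functions = {f. f holomorphic_on UNIV}"
  by (simp add: entire_functions_def space_restrict_space space_PiM)

lemma measurable_entire_eval: "(\<lambda>f. f z) \<in> borel_measurable entire_functions"
  unfolding entire_functions_def by (intro measurable_restrict_space1) measurable

text \<open>A point lies in a closed subset of a separable metric space iff, for every n, some
  element of a countable dense set is within 1/(n+1) of both the point and the subset. Here
  \<open>Qn n\<close> collects the dense elements that close to the subset, and the distance to
  \<open>f\<close> is tested only on the countable set \<open>D\<close>.\<close>

lemma has_zeros_in_measurable:
  assumes K: "compact K"
  shows "{f \<in> space entire_functions. has_zeros_in K k f} \<in> sets entire_functions"
proof -
  note measurable_entire_eval [measurable]
  obtain R where R: "\<And>z. z \<in> K \<Longrightarrow> cmod z + 1 \<le> R"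
  proof -
    obtain B where "\<And>z. z \<in> K \<Longrightarrow> cmod z \<le> B" using compact_imp_bounded[OF K] bounded_iff by metis
    then show ?thesis using that[of "B + 1"] by auto
  qed
  obtain Q where Q: "countable Q" "\<And>q. q \<in> Q \<Longrightarrow> q holomorphic_on UNIV"
    "\<And>f e. f holomorphic_on UNIV \<Longrightarrow> e > 0 \<Longrightarrow> \<exists>q\<in>Q. \<forall>w\<in>cball 0 R. cmod (f w - q w) \<le> e"
    using countable_dense_entire[of R] by blast
  obtain D where D: "countable D" "D \<subseteq> cball (0::complex) R" "cball 0 R \<subseteq> closure D"
    by (rule separable)
  define Qn where "Qn n = {q\<in>Q. \<exists>g. has_zeros_in K k g \<and> (\<forall>w\<in>cball 0 R. cmod (g w - q w) \<le> 1 / real (Suc n))}" for n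
  have Qn: "countable (Qn n)" for n
    using Q(1) by (auto simp: Qn_def intro: countable_subset)
  have "has_zeros_in K k f \<longleftrightarrow> (\<forall>n. \<exists>q\<in>Qn n. \<forall>w\<in>D. cmod (f w - q w) \<le> 1 / real (Suc n))"
    if f: "f holomorphic_on UNIV" for f
  proof
    assume "has_zeros_in K k f"
    then show "\<forall>n. \<exists>q\<in>Qn n. \<forall>w\<in>D. cmod (f w - q w) \<le> 1 / real (Suc n)"
      using Q(3)[OF f, of "1 / real (Suc n)" for n] D(2) unfolding Qn_def by fastforce
  next
    assume "\<forall>n. \<exists>q\<in>Qn n. \<forall>w\<in>D. cmod (f w - q w) \<le> 1 / real (Suc n)"
    then obtain q where q: "\<And>n. q n \<in> Qn n" "\<And>n w. w \<in> D \<Longrightarrow> cmod (f w - q n w) \<le> 1 / real (Suc n)"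
      by metis
    \<comment> \<open>Continuity extends the bound from \<open>D\<close> to the whole disc.\<close>
    have fq: "cmod (f w - q n w) \<le> 1 / real (Suc n)" if "w \<in> cball 0 R" for n w
    proof (rule continuous_on_closure_norm_le[of D "\<lambda>w. f w - q n w"])
      show "continuous_on (closure D) (\<lambda>w. f w - q n w)"
        using f Q(2)[of "q n"] q(1)[of n]
        by (intro continuous_on_diff holomorphic_on_imp_continuous_on) (auto simp: Qn_def intro: holomorphic_on_subset)
    qed (use q(2) that D in auto)
    have "\<forall>n. \<exists>g. has_zeros_in K k g \<and> (\<forall>w\<in>cball 0 R. cmod (g w - q n w) \<le> 1 / real (Suc n))"
      using q(1) unfolding Qn_def by blast
    then obtain g where g: "\<And>n. has_zeros_in K k (g n)"
        "\<And>n w. w \<in> cball 0 R \<Longrightarrow> cmod (g n w - q n w) \<le> 1 / real (Suc n)"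
      by metis
    \<comment> \<open>Both \<open>g n\<close> and \<open>f\<close> are within 1/(n+1) of
      \<open>q n\<close>, hence within 2/(n+1) of each other, and the closedness lemma
      applies.\<close>
    have "uniform_limit (cball 0 R) g f sequentially"
    proof (rule uniform_limitI)
      fix e :: real assume e: "e > 0"
      have "(\<lambda>n. 2 / real (Suc n)) \<longlonglongrightarrow> 0"
        by (rule LIMSEQ_Suc[OF lim_const_over_n])
      then have "eventually (\<lambda>n. 2 / real (Suc n) < e) sequentially"
        using e by (rule order_tendstoD)
      then show "eventually (\<lambda>n. \<forall>w\<in>cball 0 R. dist (g n w) (f w) < e) sequentially"
      proof eventually_elim
        case (elim n)
        show ?case
        proof
          fix w assume w: "w \<in> cball (0::complex) R"
          have "dist (g n w) (f w) \<le> dist (g n w) (q n w) + dist (f w) (q n w)"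
            by (rule dist_triangle2)
          also have "\<dots> \<le> 1 / real (Suc n) + 1 / real (Suc n)"
            unfolding dist_norm by (intro add_mono fq g w)
          finally show "dist (g n w) (f w) < e" using elim by simp
        qed
      qed
    qed
    with K R g(1) show "has_zeros_in K k f"
      using f by (rule has_zeros_in_uniform_limit)
  qed
  then have "{f \<in> space entire_functions. has_zeros_in K k f} =
      {f \<in> space entire_functions. \<forall>n. \<exists>q\<in>Qn n. \<forall>w\<in>D. cmod (f w - q w) \<le> 1 / real (Suc n)}"
    by (auto simp: space_entire_functions)
  also have "\<dots> \<in> sets entire_functions"
    using Qn D(1) by (intro sets.sets_Collect_countable_All sets.sets_Collect_countable_Ex'
        sets.sets_Collect_countable_All') measurable
  finally show ?thesis .
qed

text \<open>For a nonzero entire function the count is the largest \<open>k\<close> with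
  \<open>has_zeros_in K k f\<close>, written as a countable supremum of scaled indicators.\<close>

lemma measurable_emeasure_zero_measure_compact:
  assumes "compact K"
  shows "(\<lambda>f. emeasure (zero_measure f) K) \<in> borel_measurable entire_functions"
proof -
  note measurable_entire_eval [measurable]
  have K: "K \<in> sets borel" "bounded K" using assms by (auto intro: borel_compact compact_imp_bounded)
  obtain D where D: "countable D" "UNIV \<subseteq> closure (D :: complex set)" by (rule separable[of UNIV])
  \<comment> \<open>Identically vanishing functions are cut out: for nonempty \<open>K\<close> they
    satisfy \<open>has_zeros_in\<close> for every \<open>k\<close>, whereas their
    \<open>zero_measure\<close> is null by convention. Vanishing on the dense set \<open>D\<close>
    detects them.\<close>
  define Z where "Z = {f \<in> space entire_functions. \<forall>w\<in>D. f w = 0}"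
  have Z: "f \<in> Z \<longleftrightarrow> (\<forall>w. f w = 0)" if "f \<in> space entire_functions" for f
    using that continuous_constant_on_closure[of D f 0] D(2) holomorphic_on_imp_continuous_on[of f UNIV]
    by (auto simp: Z_def space_entire_functions intro: continuous_on_subset)
  have [measurable]: "Z \<in> sets entire_functions"
    unfolding Z_def using D(1) by (intro sets.sets_Collect_countable_All') measurable
  have [measurable]: "{f \<in> space entire_functions. has_zeros_in K k f} \<in> sets entire_functions" for k
    by (rule has_zeros_in_measurable[OF assms])
  have "emeasure (zero_measure f) K =
      (SUP k::nat. of_nat k * indicator ({f \<in> space entire_functions. has_zeros_in K k f} - Z) f)"
    if f: "f \<in> space entire_functions" for f
  proof (cases "f \<in> Z")
    case True
    then show ?thesis using Z[OF f] emeasure_zero_measure_zero[of f K] by simp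
  next
    case False
    then obtain a where a: "f a \<noteq> 0" using Z[OF f] by auto
    have hol: "f holomorphic_on UNIV" using f by (simp add: space_entire_functions)
    obtain n where n: "emeasure (zero_measure f) K = of_nat n"
      using emeasure_zero_measure_finite[OF hol K(2,1)] .
    have "has_zeros_in K k f \<longleftrightarrow> k \<le> n" for k
      using has_zeros_in_iff[OF hol a K(1), of k] n by simp
    then have eq: "of_nat k * indicator ({f \<in> space entire_functions. has_zeros_in K k f} - Z) f =
        (if k \<le> n then of_nat k else 0 :: ennreal)" for k :: nat
      using f False by (auto simp: indicator_def)
    show ?thesis unfolding n eq
    proof (rule antisym)
      show "(of_nat n :: ennreal) \<le> (SUP k. if k \<le> n then of_nat k else 0)"
        by (rule SUP_upper2[of n]) simp_all
      show "(SUP k. if k \<le> n then of_nat k else 0) \<le> (of_nat n :: ennreal)"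
        by (rule SUP_least) simp
    qed
  qed
  then show ?thesis
    by (subst measurable_cong) measurable
qed

section \<open>From compact sets to bounded Borel sets\<close>

lemma sigma_sets_compact:
  "sigma_sets UNIV {K. compact K} = sets (borel :: 'a :: euclidean_space measure)"
proof (rule antisym)
  show "sigma_sets UNIV {K. compact K} \<subseteq> sets (borel :: 'a measure)"
    by (rule sets.sigma_sets_subset[of _ borel, simplified]) (auto intro: borel_compact)
  have "X \<in> sigma_sets UNIV {K. compact K}" if "closed X" for X :: "'a set"
  proof -
    have "X = (\<Union>n::nat. X \<inter> cball 0 (real n))"
      using real_arch_simple by auto
    moreover have "X \<inter> cball 0 (real n) \<in> sigma_sets UNIV {K. compact K}" for n
      using that by (intro sigma_sets.Basic) (simp add: closed_Int_compact)
    ultimately show ?thesis by (metis sigma_sets.Union)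
  qed
  then show "sets (borel :: 'a measure) \<subseteq> sigma_sets UNIV {K. compact K}"
    unfolding borel_eq_closed by simp (intro sigma_sets_mono, auto)
qed

text \<open>The Dynkin induction runs over \<open>B \<inter> C\<close> with \<open>C\<close> the
  fixed closure of \<open>A\<close>. On the whole plane the zero measure may be infinite, and the
  complement step subtracts, which requires finite values.\<close>

lemma measurable_emeasure_zero_measure:
  assumes "A \<in> sets borel" "bounded A"
  shows "(\<lambda>f. emeasure (zero_measure f) A) \<in> borel_measurable entire_functions"
proof -
  have meas: "sigma_sets UNIV {K. compact K} = sets (borel :: complex measure)"
    by (rule sigma_sets_compact)
  define C where "C = closure A"
  have C: "compact C" using assms(2) by (simp add: C_def)
  then have [measurable]: "C \<in> sets borel" by (rule borel_compact)
  have "Int_stable {K :: complex set. compact K}" by (auto simp: Int_stable_def)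
  moreover have "{K :: complex set. compact K} \<subseteq> Pow UNIV" by simp
  moreover have "A \<in> sigma_sets UNIV {K. compact K}" using assms(1) meas by simp
  ultimately have "(\<lambda>f. emeasure (zero_measure f) (A \<inter> C)) \<in> borel_measurable entire_functions"
  proof (induction rule: sigma_sets_induct_disjoint)
    case (basic K)
    then show ?case using C by (intro measurable_emeasure_zero_measure_compact) auto
  next
    case (compl B)
    then have [measurable]: "B \<in> sets borel" by (simp add: meas)
    have "emeasure (zero_measure f) ((UNIV - B) \<inter> C) =
        emeasure (zero_measure f) C - emeasure (zero_measure f) (B \<inter> C)"
      if "f \<in> space entire_functions" for f
    proof -
      have "(UNIV - B) \<inter> C = C - B \<inter> C" by auto
      moreover have "bounded (B \<inter> C)"
        by (rule bounded_subset[OF compact_imp_bounded[OF C]]) simp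
      then have "emeasure (zero_measure f) (B \<inter> C) \<noteq> \<infinity>"
        using that emeasure_zero_measure_finite[of f "B \<inter> C"]
        by (metis (mono_tags, lifting) \<open>B \<in> sets borel\<close> \<open>C \<in> sets borel\<close> sets.Int
            ennreal_of_nat_neq_top infinity_ennreal_def mem_Collect_eq space_entire_functions)
      ultimately show ?thesis by (simp add: emeasure_Diff[of _ "B \<inter> C" C])
    qed
    moreover have [measurable]: "(\<lambda>f. emeasure (zero_measure f) C) \<in> borel_measurable entire_functions"
      by (rule measurable_emeasure_zero_measure_compact[OF C])
    note compl(2)[measurable]
    ultimately show ?case by (subst measurable_cong) measurable
  next
    case (union B)
    then have B [measurable]: "B i \<in> sets borel" for i using meas by blast
    have "disjoint_family (\<lambda>i. B i \<inter> C)" using union(1) by (auto simp: disjoint_family_on_def)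
    moreover have "range (\<lambda>i. B i \<inter> C) \<subseteq> sets borel" by auto
    ultimately have "emeasure (zero_measure f) ((\<Union>i. B i) \<inter> C) = (\<Sum>i. emeasure (zero_measure f) (B i \<inter> C))" for f
      using suminf_emeasure[of "\<lambda>i. B i \<inter> C" "zero_measure f"] by simp
    then show ?case using union(3) by simp
  qed auto
  moreover have "A \<inter> C = A" using closure_subset C_def by auto
  ultimately show ?thesis by simp
qed

lemma measurable_zero_measure: "zero_measure \<in> measurable entire_functions random_measure_algebra"
  unfolding random_measure_algebra_def
proof (rule measurable_SUP2)
  show "{A \<in> sets borel. bounded (A :: complex set)} \<noteq> {}" by (auto intro!: exI[of _ "{}"])
  show "zero_measure \<in> measurable entire_functions
      (vimage_algebra locally_finite_measures (\<lambda>\<mu>. emeasure \<mu> A) borel)"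
    if "A \<in> {A \<in> sets borel. bounded A}" for A
    using that measurable_emeasure_zero_measure zero_measure_locally_finite
    by (intro measurable_vimage_algebra2) (auto simp: space_entire_functions)
qed auto

section \<open>Uniqueness for multivariate characteristic functions\<close>

lemma borel_measurable_cnj [measurable]: "cnj \<in> borel_measurable borel"
  by (intro borel_measurable_continuous_onI continuous_intros)

context
  fixes M :: "'a measure" and N :: "'b measure"
  assumes M: "prob_space M" and N: "prob_space N"
begin

interpretation M: prob_space M by (rule M)
interpretation N: prob_space N by (rule N)

text \<open>
  A weight bounded away from \<open>0\<close> can be normalised to a probability density, so that the uniqueness
  theorem applies; a general bounded weight is reduced to this case by adding \<open>2\<close>.
\<close>

lemma integral_indicator_eq_of_char_pos:
  fixes X :: "'a \<Rightarrow> real" and Y :: "'b \<Rightarrow> real" and u v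
  assumes [measurable]: "X \<in> borel_measurable M" "Y \<in> borel_measurable N"
    "u \<in> borel_measurable M" "v \<in> borel_measurable N"
    and u: "\<And>x. 1 \<le> u x \<and> u x \<le> (3::real)" and v: "\<And>x. 1 \<le> v x \<and> v x \<le> (3::real)"
    and eq: "\<And>s. (CLINT x|M. iexp (s * X x) * u x) = (CLINT x|N. iexp (s * Y x) * v x)"
    and [measurable]: "B \<in> sets borel"
  shows "(LINT x|M. indicator B (X x) * u x) = (LINT x|N. indicator B (Y x) * v x)"
proof -
  have "\<bar>u x\<bar> \<le> 3" "\<bar>v y\<bar> \<le> 3" for x y using u[of x] v[of y] by auto
  then have iu: "integrable M u" and iv: "integrable N v"
    by (auto intro!: M.integrable_const_bound[of _ 3] N.integrable_const_bound[of _ 3])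
  define c where "c = (LINT x|M. u x)"
  \<comment> \<open>Frequency 0 shows that both weights have the same total mass, so one constant
    normalises both.\<close>
  have "complex_of_real c = complex_of_real (LINT x|N. v x)"
    using eq[of 0] unfolding c_def by simp
  then have cN: "c = (LINT x|N. v x)" by (simp only: of_real_eq_iff)
  have "(LINT x|M. 1) \<le> c" unfolding c_def by (rule integral_mono) (use u iu in auto)
  then have c: "c \<ge> 1" by (simp add: M.prob_space)
  define \<mu> where "\<mu> = distr (density M (\<lambda>x. ennreal (u x / c))) borel X"
  define \<nu> where "\<nu> = distr (density N (\<lambda>x. ennreal (v x / c))) borel Y"
  have nn: "0 \<le> u x / c" "0 \<le> v y / c" for x y
    using u[of x] v[of y] c by auto
  have "(\<integral>\<^sup>+x. ennreal (u x / c) \<partial>M) = 1"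
    using iu nn c by (subst nn_integral_eq_integral) (auto simp: c_def)
  then have pM: "prob_space (density M (\<lambda>x. ennreal (u x / c)))"
    by (intro prob_spaceI) (simp add: emeasure_density cong: nn_integral_cong)
  have "(\<integral>\<^sup>+x. ennreal (v x / c) \<partial>N) = 1"
    using iv nn c by (subst nn_integral_eq_integral) (auto simp: cN)
  then have pN: "prob_space (density N (\<lambda>x. ennreal (v x / c)))"
    by (intro prob_spaceI) (simp add: emeasure_density cong: nn_integral_cong)
  have "real_distribution \<mu>" "real_distribution \<nu>"
    unfolding \<mu>_def \<nu>_def by (auto intro!: prob_space.real_distribution_distr pM pN)
  moreover have "char \<mu> = char \<nu>"
  proof
    fix t
    have "char \<mu> t = (CLINT x|M. iexp (t * X x) * u x) / c"
      unfolding char_def \<mu>_def using nn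
      by (subst integral_distr, simp, simp, subst integral_density)
        (auto simp: scaleR_conv_of_real mult_ac simp flip: integral_divide)
    also have "\<dots> = (CLINT x|N. iexp (t * Y x) * v x) / c" by (simp only: eq)
    also have "\<dots> = char \<nu> t"
      unfolding char_def \<nu>_def using nn
      by (subst integral_distr, simp, simp, subst integral_density)
        (auto simp: scaleR_conv_of_real mult_ac simp flip: integral_divide)
    finally show "char \<mu> t = char \<nu> t" .
  qed
  ultimately have "\<mu> = \<nu>" by (rule Levy_uniqueness)
  have "(LINT x|M. indicator B (X x) * u x) / c = (LINT x|\<mu>. indicator B x)"
    unfolding \<mu>_def using nn
    by (subst integral_distr, simp, simp, subst integral_density)
      (auto simp: mult_ac simp flip: integral_divide)
  also have "\<dots> = (LINT x|\<nu>. indicator B x)" using \<open>\<mu> = \<nu>\<close> by simp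
  also have "\<dots> = (LINT x|N. indicator B (Y x) * v x) / c"
    unfolding \<nu>_def using nn
    by (subst integral_distr, simp, simp, subst integral_density)
      (auto simp: mult_ac simp flip: integral_divide)
  finally show ?thesis using c by simp
qed

text \<open>The weights 2 + Re U and 2 + Re V take values in [1, 3], as the previous lemma wants.
  Their weighted characteristic functions agree because Re U is the mean of U and its
  conjugate.\<close>

lemma integral_indicator_eq_of_char_Re:
  fixes X :: "'a \<Rightarrow> real" and Y :: "'b \<Rightarrow> real" and U V
  assumes [measurable]: "X \<in> borel_measurable M" "Y \<in> borel_measurable N"
    "U \<in> borel_measurable M" "V \<in> borel_measurable N"
    and U: "\<And>x. cmod (U x) \<le> 1" and V: "\<And>x. cmod (V x) \<le> 1"
    and eq: "\<And>s. (CLINT x|M. iexp (s * X x) * U x) = (CLINT x|N. iexp (s * Y x) * V x)"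
    and eq1: "\<And>s. (CLINT x|M. iexp (s * X x)) = (CLINT x|N. iexp (s * Y x))"
    and B [measurable]: "B \<in> sets borel"
  shows "(LINT x|M. indicator B (X x) * Re (U x)) = (LINT x|N. indicator B (Y x) * Re (V x))"
proof -
  have iM: "integrable M (\<lambda>x. f x)" if "f \<in> borel_measurable M" "\<And>x. cmod (f x) \<le> 1" for f
    using that by (intro M.integrable_const_bound[of _ 1]) auto
  have iN: "integrable N (\<lambda>x. f x)" if "f \<in> borel_measurable N" "\<And>x. cmod (f x) \<le> 1" for f
    using that by (intro N.integrable_const_bound[of _ 1]) auto
  have ReU: "\<bar>Re (U x)\<bar> \<le> 1" for x using abs_Re_le_cmod[of "U x"] U[of x] by linarith
  have ReV: "\<bar>Re (V x)\<bar> \<le> 1" for x using abs_Re_le_cmod[of "V x"] V[of x] by linarith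
  \<comment> \<open>Conjugating the weight amounts to conjugating the integral at the opposite
    frequency, so \<open>eq\<close> at \<open>-s\<close> covers it.\<close>
  have cnjM: "(CLINT x|M. iexp (s * X x) * cnj (U x)) = cnj (CLINT x|M. iexp ((-s) * X x) * U x)" for s
  proof -
    have "iexp (s * X x) * cnj (U x) = cnj (iexp ((-s) * X x) * U x)" for x
      by (simp add: exp_cnj)
    then show ?thesis by (simp only: Bochner_Integration.integral_cnj)
  qed
  have cnjN: "(CLINT x|N. iexp (s * Y x) * cnj (V x)) = cnj (CLINT x|N. iexp ((-s) * Y x) * V x)" for s
  proof -
    have "iexp (s * Y x) * cnj (V x) = cnj (iexp ((-s) * Y x) * V x)" for x
      by (simp add: exp_cnj)
    then show ?thesis by (simp only: Bochner_Integration.integral_cnj)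
  qed
  have split: "e * complex_of_real (2 + Re a) = 2 * e + (e * a + e * cnj a) / 2" for e a
  proof -
    have "complex_of_real (2 + Re a) = 2 + (a + cnj a) / 2" by (simp add: complex_add_cnj)
    then show ?thesis by (simp only:) (simp add: distrib_left)
  qed
  have iM2: "integrable M (\<lambda>x. iexp (s * X x))" "integrable M (\<lambda>x. iexp (s * X x) * U x)"
      "integrable M (\<lambda>x. iexp (s * X x) * cnj (U x))" for s
    by (rule iM; use U in \<open>simp add: norm_mult\<close>)+
  have iN2: "integrable N (\<lambda>x. iexp (s * Y x))" "integrable N (\<lambda>x. iexp (s * Y x) * V x)"
      "integrable N (\<lambda>x. iexp (s * Y x) * cnj (V x))" for s
    by (rule iN; use V in \<open>simp add: norm_mult\<close>)+
  have 1: "(LINT x|M. indicator B (X x) * (2 + Re (U x))) = (LINT x|N. indicator B (Y x) * (2 + Re (V x)))"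
  proof (rule integral_indicator_eq_of_char_pos)
    fix s
    have "(CLINT x|M. iexp (s * X x) * complex_of_real (2 + Re (U x))) =
        2 * (CLINT x|M. iexp (s * X x)) + ((CLINT x|M. iexp (s * X x) * U x) + (CLINT x|M. iexp (s * X x) * cnj (U x))) / 2"
      unfolding split using iM2[of s] by simp
    also have "\<dots> = 2 * (CLINT x|N. iexp (s * Y x)) + ((CLINT x|N. iexp (s * Y x) * V x) + (CLINT x|N. iexp (s * Y x) * cnj (V x))) / 2"
      unfolding cnjM cnjN eq eq1 ..
    also have "\<dots> = (CLINT x|N. iexp (s * Y x) * complex_of_real (2 + Re (V x)))"
      unfolding split using iN2[of s] by simp
    finally show "(CLINT x|M. iexp (s * X x) * complex_of_real (2 + Re (U x))) =
      (CLINT x|N. iexp (s * Y x) * complex_of_real (2 + Re (V x)))" .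
  next
    show "1 \<le> 2 + Re (U x) \<and> 2 + Re (U x) \<le> 3" for x using ReU[of x] by auto
    show "1 \<le> 2 + Re (V x) \<and> 2 + Re (V x) \<le> 3" for x using ReV[of x] by auto
  qed measurable
  \<comment> \<open>The constant weight 2, to be subtracted from the identity above; only the
    unweighted characteristic functions enter.\<close>
  have 2: "(LINT x|M. indicator B (X x) * (2::real)) = (LINT x|N. indicator B (Y x) * 2)"
    by (rule integral_indicator_eq_of_char_pos) (use eq1 in auto)
  have "integrable M (\<lambda>x. indicator B (X x) * Re (U x))"
    by (rule M.integrable_const_bound[of _ 1]) (use ReU in \<open>auto simp: indicator_def\<close>)
  moreover have "integrable N (\<lambda>x. indicator B (Y x) * Re (V x))"
    by (rule N.integrable_const_bound[of _ 1]) (use ReV in \<open>auto simp: indicator_def\<close>)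
  moreover have "integrable M (\<lambda>x. indicator B (X x) * (2::real))"
    by (rule M.integrable_const_bound[of _ 2]) (auto simp: indicator_def)
  moreover have "integrable N (\<lambda>x. indicator B (Y x) * (2::real))"
    by (rule N.integrable_const_bound[of _ 2]) (auto simp: indicator_def)
  ultimately show ?thesis
    using 1 2 by (simp add: distrib_left)
qed

lemma integral_indicator_eq_of_char:
  fixes X :: "'a \<Rightarrow> real" and Y :: "'b \<Rightarrow> real" and U V
  assumes [measurable]: "X \<in> borel_measurable M" "Y \<in> borel_measurable N"
    "U \<in> borel_measurable M" "V \<in> borel_measurable N"
    and U: "\<And>x. cmod (U x) \<le> 1" and V: "\<And>x. cmod (V x) \<le> 1"
    and eq: "\<And>s. (CLINT x|M. iexp (s * X x) * U x) = (CLINT x|N. iexp (s * Y x) * V x)"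
    and eq1: "\<And>s. (CLINT x|M. iexp (s * X x)) = (CLINT x|N. iexp (s * Y x))"
    and B [measurable]: "B \<in> sets borel"
  shows "(CLINT x|M. indicator B (X x) * U x) = (CLINT x|N. indicator B (Y x) * V x)"
proof -
  have iM: "integrable M (\<lambda>x. indicator B (X x) * U x)"
    by (rule M.integrable_const_bound[of _ 1]) (use U in \<open>auto simp: indicator_def\<close>)
  have iN: "integrable N (\<lambda>x. indicator B (Y x) * V x)"
    by (rule N.integrable_const_bound[of _ 1]) (use V in \<open>auto simp: indicator_def\<close>)
  have Re_ind: "Re (indicator B x * z) = indicator B x * Re z" "Im (indicator B x * z) = indicator B x * Im z"
    for x z by (auto simp: indicator_def)
  have Re_eq: "(LINT x|M. indicator B (X x) * Re (U x)) = (LINT x|N. indicator B (Y x) * Re (V x))"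
    by (rule integral_indicator_eq_of_char_Re) (use U V eq eq1 in auto)
  \<comment> \<open>The imaginary part of U is the real part of -i U, so the real case is applied
    once more to the rotated weights.\<close>
  have "(CLINT x|M. iexp (s * X x) * (- \<i> * U x)) = - \<i> * (CLINT x|M. iexp (s * X x) * U x)" for s
    by (simp add: mult.left_commute flip: integral_mult_right_zero)
  moreover have "(CLINT x|N. iexp (s * Y x) * (- \<i> * V x)) = - \<i> * (CLINT x|N. iexp (s * Y x) * V x)" for s
    by (simp add: mult.left_commute flip: integral_mult_right_zero)
  ultimately have "(LINT x|M. indicator B (X x) * Re (- \<i> * U x)) = (LINT x|N. indicator B (Y x) * Re (- \<i> * V x))"
    by (intro integral_indicator_eq_of_char_Re) (use U V eq eq1 in \<open>auto simp: norm_mult\<close>)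
  then have "(LINT x|M. indicator B (X x) * Im (U x)) = (LINT x|N. indicator B (Y x) * Im (V x))"
    by simp
  with Re_eq show ?thesis
    unfolding complex_eq_iff integral_Re[OF iM, symmetric] integral_Re[OF iN, symmetric]
      integral_Im[OF iM, symmetric] integral_Im[OF iN, symmetric] Re_ind by blast
qed

text \<open>
  Induction over the coordinates reduces to the one-dimensional uniqueness theorem: the factors
  \<open>iexp (t j * X j)\<close> are replaced by indicators one by one, the remaining ones being carried
  along in the weight.
\<close>

lemma integral_prod_indicator_eq_of_char:
  fixes X :: "'i \<Rightarrow> 'a \<Rightarrow> real" and Y :: "'i \<Rightarrow> 'b \<Rightarrow> real" and U V
  assumes "finite J"
    and "\<And>j. j \<in> J \<Longrightarrow> X j \<in> borel_measurable M" "\<And>j. j \<in> J \<Longrightarrow> Y j \<in> borel_measurable N"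
    and "U \<in> borel_measurable M" "V \<in> borel_measurable N"
    and "\<And>x. cmod (U x) \<le> 1" "\<And>x. cmod (V x) \<le> 1"
    and "\<And>t. (CLINT x|M. iexp (\<Sum>j\<in>J. t j * X j x) * U x) = (CLINT x|N. iexp (\<Sum>j\<in>J. t j * Y j x) * V x)"
    and "\<And>t. (CLINT x|M. iexp (\<Sum>j\<in>J. t j * X j x)) = (CLINT x|N. iexp (\<Sum>j\<in>J. t j * Y j x))"
    and "\<And>j. j \<in> J \<Longrightarrow> B j \<in> sets borel"
  shows "(CLINT x|M. (\<Prod>j\<in>J. indicator (B j) (X j x)) * U x) = (CLINT x|N. (\<Prod>j\<in>J. indicator (B j) (Y j x)) * V x)"
  using assms
proof (induction J arbitrary: U V)
  case empty
  show ?case using empty(7)[of "\<lambda>_. 0"] by simp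
next
  case (insert j J)
  note [measurable] = insert.prems(1-4,9)
  have [measurable]: "X j \<in> borel_measurable M" "Y j \<in> borel_measurable N" "B j \<in> sets borel"
    using insert.prems by auto
  have [measurable]: "i \<in> J \<Longrightarrow> X i \<in> borel_measurable M" "i \<in> J \<Longrightarrow> Y i \<in> borel_measurable N"
    "i \<in> J \<Longrightarrow> B i \<in> sets borel" for i
    using insert.prems by auto
  let ?P = "\<lambda>x. (\<Prod>i\<in>J. indicator (B i) (X i x)) :: complex" and ?Q = "\<lambda>x. (\<Prod>i\<in>J. indicator (B i) (Y i x)) :: complex"
  have [measurable]: "?P \<in> borel_measurable M" "?Q \<in> borel_measurable N" by measurable
  have PQ: "cmod (?P x) \<le> 1" "cmod (?Q y) \<le> 1" for x y
    unfolding prod_norm[symmetric] by (auto intro!: prod_le_1 simp: indicator_def)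
  have upd: "(\<Sum>i\<in>insert j J. (t(j := s)) i * f i) = s * f j + (\<Sum>i\<in>J. t i * f i)" for t f and s :: real
    using insert.hyps by (auto intro!: sum.cong)
  have e1: "(CLINT x|M. iexp (\<Sum>i\<in>J. t i * X i x) * (iexp (s * X j x) * U x)) =
      (CLINT x|N. iexp (\<Sum>i\<in>J. t i * Y i x) * (iexp (s * Y j x) * V x))" for t s
    using insert.prems(7)[of "t(j := s)"] unfolding upd
    by (simp only: of_real_add distrib_left exp_add mult_ac)
  have e0: "(CLINT x|M. iexp (\<Sum>i\<in>J. t i * X i x)) = (CLINT x|N. iexp (\<Sum>i\<in>J. t i * Y i x))" for t
    using insert.prems(8)[of "t(j := 0)"] unfolding upd by simp
  \<comment> \<open>The new coordinate joins the weight as a unimodular factor, so the bound 1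
    survives and the induction hypothesis replaces the other coordinates by indicators.\<close>
  have "(CLINT x|M. ?P x * (iexp (s * X j x) * U x)) = (CLINT x|N. ?Q x * (iexp (s * Y j x) * V x))" for s
    by (rule insert.IH) (use insert.prems(5,6) e1 e0 in \<open>auto simp: norm_mult\<close>)
  then have e2: "(CLINT x|M. iexp (s * X j x) * (?P x * U x)) = (CLINT x|N. iexp (s * Y j x) * (?Q x * V x))" for s
    by (simp only: mult_ac)
  have e3: "(CLINT x|M. iexp (s * X j x)) = (CLINT x|N. iexp (s * Y j x))" for s
    using insert.prems(8)[of "(\<lambda>_. 0)(j := s)"] unfolding upd by simp
  \<comment> \<open>The roles are exchanged: the indicators already obtained are now part of the
    weight, and one-dimensional uniqueness is applied in coordinate \<open>j\<close>.\<close>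
  have "(CLINT x|M. indicator (B j) (X j x) * (?P x * U x)) = (CLINT x|N. indicator (B j) (Y j x) * (?Q x * V x))"
    by (rule integral_indicator_eq_of_char)
      (use PQ insert.prems(5,6) e2 e3 in \<open>auto simp: norm_mult intro!: mult_le_one\<close>)
  then show ?case using insert.hyps by (simp add: mult.assoc)
qed

text \<open>With weight 1 the integrated product of indicators is the probability of a box, and
  boxes are an intersection-stable generator of the product sigma-algebra.\<close>

lemma distr_PiM_eq_of_char_real:
  fixes X :: "'i \<Rightarrow> 'a \<Rightarrow> real" and Y :: "'i \<Rightarrow> 'b \<Rightarrow> real"
  assumes J: "finite J"
    and [measurable]: "\<And>j. j \<in> J \<Longrightarrow> X j \<in> borel_measurable M" "\<And>j. j \<in> J \<Longrightarrow> Y j \<in> borel_measurable N"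
    and eq: "\<And>t. (CLINT x|M. iexp (\<Sum>j\<in>J. t j * X j x)) = (CLINT x|N. iexp (\<Sum>j\<in>J. t j * Y j x))"
  shows "distr M (PiM J (\<lambda>_. borel)) (\<lambda>x. \<lambda>j\<in>J. X j x) = distr N (PiM J (\<lambda>_. borel)) (\<lambda>x. \<lambda>j\<in>J. Y j x)"
    (is "?D = ?E")
proof -
  interpret D: prob_space ?D by (rule M.prob_space_distr) measurable
  interpret E: prob_space ?E by (rule N.prob_space_distr) measurable
  have "?D (Pi\<^sub>E J A) = ?E (Pi\<^sub>E J A)" if A: "\<And>i. i \<in> J \<Longrightarrow> A i \<in> sets borel" for A
  proof -
    note A[measurable]
    have "Pi\<^sub>E J A \<in> sets (PiM J (\<lambda>_. borel))" using J A by (intro sets_PiM_I_finite) auto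
    then have "measure ?D (Pi\<^sub>E J A) = measure M {x\<in>space M. \<forall>j\<in>J. X j x \<in> A j}"
      "measure ?E (Pi\<^sub>E J A) = measure N {x\<in>space N. \<forall>j\<in>J. Y j x \<in> A j}"
      by (auto simp: measure_distr intro!: arg_cong2[where f=measure])
    moreover have "(CLINT x|M. (\<Prod>j\<in>J. indicator (A j) (X j x)) * 1) = (CLINT x|N. (\<Prod>j\<in>J. indicator (A j) (Y j x)) * 1)"
      by (rule integral_prod_indicator_eq_of_char) (use J A eq in auto)
    moreover have "(CLINT x|M. (\<Prod>j\<in>J. indicator (A j) (X j x)) * 1) =
        (CLINT x|M. of_real (indicator {x\<in>space M. \<forall>j\<in>J. X j x \<in> A j} x))"
      using J by (intro Bochner_Integration.integral_cong) (auto simp: indicator_def intro: prod_zero)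
    moreover have "(CLINT x|N. (\<Prod>j\<in>J. indicator (A j) (Y j x)) * 1) =
        (CLINT x|N. of_real (indicator {x\<in>space N. \<forall>j\<in>J. Y j x \<in> A j} x))"
      using J by (intro Bochner_Integration.integral_cong) (auto simp: indicator_def intro: prod_zero)
    ultimately have "measure ?D (Pi\<^sub>E J A) = measure ?E (Pi\<^sub>E J A)"
      by (simp add: Int_absorb2 Collect_mono)
    then show ?thesis by (simp add: D.emeasure_eq_measure E.emeasure_eq_measure)
  qed
  then show ?thesis
  proof (rule measure_eqI_PiM_finite[OF J, rotated 2])
    show "range (\<lambda>_::nat. \<Pi>\<^sub>E j\<in>J. UNIV) \<subseteq> prod_algebra J (\<lambda>_. borel :: real measure)"
      using J by (auto intro!: prod_algebraI_finite)
  qed (simp_all add: space_PiM D.emeasure_eq_measure)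
qed

text \<open>A complex vector is a real one over \<open>J \<times> UNIV\<close>, the Boolean
  selecting real or imaginary part. A real functional with coefficients a, b on these parts is the
  real part of multiplication by a - i b, so complex coefficients \<open>d\<close> exhaust all real
  frequencies.\<close>

lemma distr_PiM_eq_of_char:
  fixes X :: "'i \<Rightarrow> 'a \<Rightarrow> complex" and Y :: "'i \<Rightarrow> 'b \<Rightarrow> complex"
  assumes J: "finite J"
    and [measurable]: "\<And>j. j \<in> J \<Longrightarrow> X j \<in> borel_measurable M" "\<And>j. j \<in> J \<Longrightarrow> Y j \<in> borel_measurable N"
    and eq: "\<And>d. (CLINT x|M. iexp (Re (\<Sum>j\<in>J. d j * X j x))) = (CLINT x|N. iexp (Re (\<Sum>j\<in>J. d j * Y j x)))"
  shows "distr M (PiM J (\<lambda>_. borel)) (\<lambda>x. \<lambda>j\<in>J. X j x) = distr N (PiM J (\<lambda>_. borel)) (\<lambda>x. \<lambda>j\<in>J. Y j x)"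
proof -
  let ?K = "J \<times> (UNIV :: bool set)"
  define part where "part p z = (if snd p then Re z else Im z)" for p :: "'i \<times> bool" and z
  have [measurable]: "part p \<in> borel_measurable borel" for p
    unfolding part_def by (cases "snd p") simp_all
  define G where "G y = (\<lambda>j\<in>J. Complex (y (j, True)) (y (j, False)))" for y :: "'i \<times> bool \<Rightarrow> real"
  have [measurable]: "G \<in> measurable (PiM ?K (\<lambda>_. borel)) (PiM J (\<lambda>_. borel))"
    unfolding G_def Complex_eq by measurable
  have sum: "(\<Sum>p\<in>?K. t p * part p (Z (fst p))) = Re (\<Sum>j\<in>J. Complex (t (j, True)) (- t (j, False)) * Z j)"
    for t :: "'i \<times> bool \<Rightarrow> real" and Z
  proof -
    have "(\<Sum>p\<in>?K. t p * part p (Z (fst p))) = (\<Sum>j\<in>J. \<Sum>b\<in>UNIV. t (j, b) * part (j, b) (Z j))"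
      by (simp add: sum.cartesian_product split_beta')
    then show ?thesis by (simp add: UNIV_bool part_def add.commute)
  qed
  have "distr M (PiM ?K (\<lambda>_. borel)) (\<lambda>x. \<lambda>p\<in>?K. part p (X (fst p) x)) =
      distr N (PiM ?K (\<lambda>_. borel)) (\<lambda>x. \<lambda>p\<in>?K. part p (Y (fst p) x))"
  proof (rule distr_PiM_eq_of_char_real)
    show "(CLINT x|M. iexp (\<Sum>p\<in>?K. t p * part p (X (fst p) x))) =
        (CLINT x|N. iexp (\<Sum>p\<in>?K. t p * part p (Y (fst p) x)))" for t
      unfolding sum[of t "\<lambda>j. X j x" for x] sum[of t "\<lambda>j. Y j x" for x] by (rule eq)
  qed (use J in auto)
  then have "distr (distr M (PiM ?K (\<lambda>_. borel)) (\<lambda>x. \<lambda>p\<in>?K. part p (X (fst p) x))) (PiM J (\<lambda>_. borel)) G =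
      distr (distr N (PiM ?K (\<lambda>_. borel)) (\<lambda>x. \<lambda>p\<in>?K. part p (Y (fst p) x))) (PiM J (\<lambda>_. borel)) G"
    by simp
  moreover have "G (\<lambda>p\<in>?K. part p (X (fst p) x)) = (\<lambda>j\<in>J. X j x)"
    "G (\<lambda>p\<in>?K. part p (Y (fst p) y)) = (\<lambda>j\<in>J. Y j y)" for x y
    by (auto simp: G_def part_def)
  moreover have "(\<lambda>x. \<lambda>p\<in>?K. part p (X (fst p) x)) \<in> measurable M (PiM ?K (\<lambda>_. borel))"
    "(\<lambda>x. \<lambda>p\<in>?K. part p (Y (fst p) x)) \<in> measurable N (PiM ?K (\<lambda>_. borel))"
    by (intro measurable_restrict; auto)+
  ultimately show ?thesis
    by (simp add: distr_distr o_def)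
qed

end

section \<open>Circular Gaussian vectors\<close>

lemma lborel_complex_eq_distr:
  "lborel = distr (lborel \<Otimes>\<^sub>M lborel) borel (\<lambda>(x, y). Complex x y)"
proof (rule lborel_eqI)
  fix l u :: complex
  assume le: "\<And>b. b \<in> Basis \<Longrightarrow> l \<bullet> b \<le> u \<bullet> b"
  have le: "Re l \<le> Re u" "Im l \<le> Im u"
    using le[of 1] le[of \<i>] by (auto simp: Basis_complex_def)
  have [measurable]: "(\<lambda>(x, y). Complex x y) \<in> borel_measurable (lborel \<Otimes>\<^sub>M lborel)"
    unfolding Complex_eq by measurable
  have "(\<lambda>(x, y). Complex x y) -` box l u \<inter> space (lborel \<Otimes>\<^sub>M lborel) = {Re l<..<Re u} \<times> {Im l<..<Im u}"
    by (auto simp: box_def Basis_complex_def space_pair_measure)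
  then have "emeasure (distr (lborel \<Otimes>\<^sub>M lborel) borel (\<lambda>(x, y). Complex x y)) (box l u) =
      ennreal ((Re u - Re l) * (Im u - Im l))"
    using le by (simp add: emeasure_distr lborel.emeasure_pair_measure_Times ennreal_mult)
  also have "(Re u - Re l) * (Im u - Im l) = (\<Prod>b\<in>Basis. (u - l) \<bullet> b)"
    by (simp add: Basis_complex_def)
  finally show "emeasure (distr (lborel \<Otimes>\<^sub>M lborel) borel (\<lambda>(x, y). Complex x y)) (box l u) =
      ennreal (\<Prod>b\<in>Basis. (u - l) \<bullet> b)" .
qed simp

text \<open>The real and imaginary part of a standard complex normal variable have variance \<open>1/2\<close>.\<close>

definition half_normal :: "real measure" where
  "half_normal = density lborel (normal_density 0 (1 / sqrt 2))"

lemma prob_space_half_normal: "prob_space half_normal"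
  unfolding half_normal_def by (rule prob_space_normal_density) simp

lemma sets_half_normal [measurable_cong, simp]: "sets half_normal = sets borel"
  by (simp add: half_normal_def)

lemma space_half_normal [simp]: "space half_normal = UNIV"
  by (simp add: half_normal_def)

lemma sets_std_complex_normal [measurable_cong, simp]: "sets std_complex_normal = sets borel"
  by (simp add: std_complex_normal_def)

lemma space_std_complex_normal [simp]: "space std_complex_normal = UNIV"
  by (simp add: std_complex_normal_def)

text \<open>The density exp(-|z|^2)/pi factors into exp(-x^2)/sqrt(pi) and the same in y, which
  reduces moments and characteristic functions to one real variable.\<close>

lemma std_complex_normal_eq_distr:
  "std_complex_normal = distr (half_normal \<Otimes>\<^sub>M half_normal) borel (\<lambda>(x, y). Complex x y)"
proof -
  have [measurable]: "(\<lambda>(x, y). Complex x y) \<in> borel_measurable (borel \<Otimes>\<^sub>M borel)"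
    unfolding Complex_eq by measurable
  interpret prob_space half_normal by (rule prob_space_half_normal)
  have nd: "normal_density 0 (1 / sqrt 2) x = exp (- x\<^sup>2) / sqrt pi" for x
    by (simp add: normal_density_def power_divide)
  have "half_normal \<Otimes>\<^sub>M half_normal =
      density (lborel \<Otimes>\<^sub>M lborel) (\<lambda>(x, y). ennreal (normal_density 0 (1 / sqrt 2) x) * ennreal (normal_density 0 (1 / sqrt 2) y))"
    unfolding half_normal_def
    by (rule pair_measure_density) (auto intro: prob_space_imp_sigma_finite sigma_finite_lborel prob_space_half_normal[unfolded half_normal_def])
  also have "\<dots> = density (lborel \<Otimes>\<^sub>M lborel) (\<lambda>z. ennreal (exp (- (cmod (case z of (x, y) \<Rightarrow> Complex x y))\<^sup>2) / pi))"
    by (intro density_cong) (auto simp: nd cmod_power2 ennreal_mult[symmetric] mult_exp_exp)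
  finally have "half_normal \<Otimes>\<^sub>M half_normal = \<dots>" .
  then show ?thesis
    unfolding std_complex_normal_def lborel_complex_eq_distr
    by (subst density_distr) auto
qed

lemma measurable_Complex_pair: "(\<lambda>(x, y). Complex x y) \<in> borel_measurable (half_normal \<Otimes>\<^sub>M half_normal)"
  unfolding Complex_eq by measurable

lemma prob_space_std_complex_normal: "prob_space std_complex_normal"
proof -
  interpret prob_space half_normal by (rule prob_space_half_normal)
  interpret pair_prob_space half_normal half_normal ..
  show ?thesis
    unfolding std_complex_normal_eq_distr by (rule prob_space_distr[OF measurable_Complex_pair])
qed

lemma distr_std_complex_normal_Re: "distr std_complex_normal borel Re = half_normal"
proof -
  interpret prob_space half_normal by (rule prob_space_half_normal)
  have "distr std_complex_normal borel Re = distr (half_normal \<Otimes>\<^sub>M half_normal) half_normal fst"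
    unfolding std_complex_normal_eq_distr
    by (subst distr_distr[OF _ measurable_Complex_pair]) (auto intro!: distr_cong)
  then show ?thesis by (simp add: distr_pair_fst)
qed

lemma distr_std_complex_normal_Im: "distr std_complex_normal borel Im = half_normal"
proof -
  interpret prob_space half_normal by (rule prob_space_half_normal)
  interpret pair_sigma_finite half_normal half_normal ..
  have "distr std_complex_normal borel Im = distr (half_normal \<Otimes>\<^sub>M half_normal) half_normal snd"
    unfolding std_complex_normal_eq_distr
    by (subst distr_distr[OF _ measurable_Complex_pair]) (auto intro!: distr_cong)
  also have "\<dots> = half_normal"
    by (subst distr_pair_swap, subst distr_distr) (auto simp: o_def split_beta' distr_pair_fst)
  finally show ?thesis .
qed

lemma half_normal_moments:
  "integrable half_normal (\<lambda>x. x)" "(LINT x|half_normal. x) = 0"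
  "integrable half_normal (\<lambda>x. x\<^sup>2)" "(LINT x|half_normal. x\<^sup>2) = 1 / 2"
proof -
  have "has_bochner_integral lborel (\<lambda>x. normal_density 0 (1 / sqrt 2) x *\<^sub>R x) 0"
    using normal_moment_odd[of "1 / sqrt 2" 0 0] by simp
  then have "has_bochner_integral half_normal (\<lambda>x. x) 0"
    unfolding half_normal_def by (intro has_bochner_integral_density) auto
  then show "integrable half_normal (\<lambda>x. x)" "(LINT x|half_normal. x) = 0"
    by (auto simp: has_bochner_integral_iff)
  have "has_bochner_integral lborel (\<lambda>x. normal_density 0 (1 / sqrt 2) x *\<^sub>R x\<^sup>2) (1 / 2)"
    \<comment> \<open>The second moment from the formula for even moments: 2! / (4 * 1!) = 1/2,
      where 4 is 2 divided by the variance 1/2.\<close>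
    using normal_moment_even[of "1 / sqrt 2" 0 1] by (simp add: power_divide fact_numeral)
  then have "has_bochner_integral half_normal (\<lambda>x. x\<^sup>2) (1 / 2)"
    unfolding half_normal_def by (intro has_bochner_integral_density) auto
  then show "integrable half_normal (\<lambda>x. x\<^sup>2)" "(LINT x|half_normal. x\<^sup>2) = 1 / 2"
    by (auto simp: has_bochner_integral_iff)
qed

lemma std_complex_normal_moments:
  "integrable std_complex_normal (\<lambda>z. z)" "(CLINT z|std_complex_normal. z) = 0"
  "integrable std_complex_normal (\<lambda>z. z * cnj z)" "(CLINT z|std_complex_normal. z * cnj z) = 1"
proof -
  have Re: "integrable std_complex_normal Re" "(LINT z|std_complex_normal. Re z) = 0"
      "integrable std_complex_normal (\<lambda>z. (Re z)\<^sup>2)" "(LINT z|std_complex_normal. (Re z)\<^sup>2) = 1 / 2"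
    using half_normal_moments unfolding distr_std_complex_normal_Re[symmetric]
    by (simp_all add: integrable_distr_eq integral_distr)
  have Im: "integrable std_complex_normal Im" "(LINT z|std_complex_normal. Im z) = 0"
      "integrable std_complex_normal (\<lambda>z. (Im z)\<^sup>2)" "(LINT z|std_complex_normal. (Im z)\<^sup>2) = 1 / 2"
    using half_normal_moments unfolding distr_std_complex_normal_Im[symmetric]
    by (simp_all add: integrable_distr_eq integral_distr)
  have id: "(\<lambda>z. z) = (\<lambda>z. complex_of_real (Re z) + \<i> * complex_of_real (Im z))"
    by (simp flip: complex_eq)
  show "integrable std_complex_normal (\<lambda>z. z)" "(CLINT z|std_complex_normal. z) = 0"
    unfolding id using Re Im by simp_all
  have sq: "z * cnj z = complex_of_real ((Re z)\<^sup>2 + (Im z)\<^sup>2)" for z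
    by (simp add: complex_mult_cnj)
  show "integrable std_complex_normal (\<lambda>z. z * cnj z)" "(CLINT z|std_complex_normal. z * cnj z) = 1"
    unfolding sq using integrable_of_real[OF Bochner_Integration.integrable_add[OF Re(3) Im(3)], where 'a = complex]
    by (simp_all only: integral_complex_of_real Bochner_Integration.integral_add[OF Re(3) Im(3)] Re(4) Im(4)) simp
qed

lemma char_half_normal: "(CLINT x|half_normal. iexp (a * x)) = exp (- (a\<^sup>2) / 4)"
proof -
  have "(CLINT x|half_normal. iexp (a * x)) = (CLINT x|lborel. normal_density 0 (1 / sqrt 2) x *\<^sub>R iexp (a * x))"
    unfolding half_normal_def by (subst integral_density) auto
  \<comment> \<open>Rescaling by the standard deviation reduces to the standard normal law at
    frequency a / sqrt 2.\<close>
  also have "\<dots> = \<bar>1 / sqrt 2\<bar> *\<^sub>R (CLINT x|lborel. normal_density 0 (1 / sqrt 2) (0 + (1 / sqrt 2) * x) *\<^sub>R iexp (a * (0 + (1 / sqrt 2) * x)))"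
    by (rule lborel_integral_real_affine) simp
  also have "\<dots> = (CLINT x|lborel. std_normal_density x *\<^sub>R iexp ((a / sqrt 2) * x))"
    unfolding integral_scaleR_right[symmetric]
    by (intro Bochner_Integration.integral_cong)
      (auto simp: normal_density_def power_divide power_mult_distrib real_sqrt_mult scaleR_conv_of_real field_simps)
  also have "\<dots> = char std_normal_distribution (a / sqrt 2)"
    unfolding char_def by (subst integral_density) auto
  also have "\<dots> = exp (- (a\<^sup>2) / 4)"
    by (simp add: char_std_normal_distribution power_divide)
  finally show ?thesis .
qed

text \<open>Only \<open>cmod c\<close> survives, which expresses circular symmetry: Re(c z) is a
  combination of the independent parts, of variance |c|^2 / 2.\<close>

lemma char_std_complex_normal:
  "(CLINT z|std_complex_normal. iexp (Re (c * z))) = exp (- ((cmod c)\<^sup>2) / 4)"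
proof -
  interpret H: prob_space half_normal by (rule prob_space_half_normal)
  interpret P: pair_prob_space half_normal half_normal ..
  let ?f = "\<lambda>x y. iexp (Re c * x) * iexp (- Im c * y)"
  have "(CLINT z|std_complex_normal. iexp (Re (c * z))) = (CLINT p|half_normal \<Otimes>\<^sub>M half_normal. case_prod ?f p)"
    unfolding std_complex_normal_eq_distr
    by (subst integral_distr[OF measurable_Complex_pair])
      (auto intro!: Bochner_Integration.integral_cong simp: mult_exp_exp algebra_simps)
  also have "\<dots> = (CLINT x|half_normal. CLINT y|half_normal. ?f x y)"
    by (rule P.integral_fst[symmetric], rule P.integrable_const_bound[of _ 1])
      (auto simp: norm_mult)
  also have "\<dots> = (CLINT x|half_normal. iexp (Re c * x)) * (CLINT y|half_normal. iexp (- Im c * y))"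
    by simp
  also have "\<dots> = exp (- ((cmod c)\<^sup>2) / 4)"
    unfolding char_half_normal of_real_mult[symmetric] mult_exp_exp by (simp add: cmod_power2 field_simps)
  finally show ?thesis .
qed

text \<open>The representing matrix \<open>A\<close> enters the characteristic function only through
  \<open>A\<close> times its conjugate transpose, and that product is the covariance matrix. Hence
  covariances determine the law.\<close>

lemma circular_gaussian_vector_char:
  fixes X :: "'i \<Rightarrow> 'a \<Rightarrow> complex"
  assumes I: "finite I" and M: "prob_space M" and X: "circular_gaussian_vector M I X"
  shows "(CLINT \<omega>|M. iexp (Re (\<Sum>i\<in>I. d i * X i \<omega>))) =
    exp (- (\<Sum>i\<in>I. \<Sum>j\<in>I. d i * cnj (d j) * (CLINT \<omega>|M. X i \<omega> * cnj (X j \<omega>))) / 4)"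
proof -
  obtain m :: nat and A where
    distr: "distr M (PiM I (\<lambda>_. borel)) (\<lambda>\<omega>. \<lambda>i\<in>I. X i \<omega>) =
        distr (PiM {..<m} (\<lambda>_. std_complex_normal)) (PiM I (\<lambda>_. borel)) (\<lambda>\<zeta>. \<lambda>i\<in>I. \<Sum>k<m. A i k * \<zeta> k)"
    and [measurable]: "\<And>i. i \<in> I \<Longrightarrow> X i \<in> borel_measurable M"
    using X unfolding circular_gaussian_vector_def by auto
  interpret S: prob_space std_complex_normal by (rule prob_space_std_complex_normal)
  interpret P: product_prob_space "\<lambda>_. std_complex_normal" "{..<m}" ..
  let ?P = "PiM {..<m} (\<lambda>_. std_complex_normal)"
  let ?Z = "\<lambda>\<zeta>. \<lambda>i\<in>I. \<Sum>k<m. A i k * \<zeta> k"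
  have [measurable]: "(\<lambda>\<zeta>. \<zeta> k) \<in> borel_measurable ?P" if "k < m" for k
    using measurable_component_singleton[of k "{..<m}" "\<lambda>_. std_complex_normal"] that by simp
  \<comment> \<open>Integrals of functions of the vector depend only on its law, so covariances and
    characteristic function can both be computed on the model built from independent standard
    variables.\<close>
  have transfer: "(CLINT \<omega>|M. \<phi> (\<lambda>i\<in>I. X i \<omega>)) = (CLINT \<zeta>|?P. \<phi> (?Z \<zeta>))"
    if \<phi>: "\<phi> \<in> borel_measurable (PiM I (\<lambda>_. borel))" for \<phi> :: "('i \<Rightarrow> complex) \<Rightarrow> complex"
  proof -
    have "(CLINT \<omega>|M. \<phi> (\<lambda>i\<in>I. X i \<omega>)) = integral\<^sup>L (distr M (PiM I (\<lambda>_. borel)) (\<lambda>\<omega>. \<lambda>i\<in>I. X i \<omega>)) \<phi>"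
      by (rule integral_distr[symmetric, OF _ \<phi>]) measurable
    also have "\<dots> = (CLINT \<zeta>|?P. \<phi> (?Z \<zeta>))"
      unfolding distr by (rule integral_distr[OF _ \<phi>]) measurable
    finally show ?thesis .
  qed
  have cov_std: "integrable ?P (\<lambda>\<zeta>. \<zeta> k * cnj (\<zeta> l))"
      "(CLINT \<zeta>|?P. \<zeta> k * cnj (\<zeta> l)) = (if k = l then 1 else 0)" if kl: "k < m" "l < m" for k l
  proof -
    \<comment> \<open>Writes the mixed second moment as a product over all coordinates, so that
      independence splits the integral; for \<open>k = l\<close> the two factors meet in the same
      coordinate.\<close>
    define f where "f i z = (if i = k then z else 1) * (if i = l then cnj z else 1)" for i z
    have int: "integrable std_complex_normal (f i)" for i
      unfolding f_def using std_complex_normal_moments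
      by (cases "i = k"; cases "i = l") auto
    have prod: "(\<Prod>i<m. f i (\<zeta> i)) = \<zeta> k * cnj (\<zeta> l)" for \<zeta>
      unfolding f_def prod.distrib using kl by (simp add: prod.delta)
    show "integrable ?P (\<lambda>\<zeta>. \<zeta> k * cnj (\<zeta> l))"
      using P.product_integrable_prod[of "{..<m}" f] int unfolding prod by simp
    have "(CLINT \<zeta>|?P. \<zeta> k * cnj (\<zeta> l)) = (\<Prod>i<m. (CLINT z|std_complex_normal. f i z))"
      using P.product_integral_prod[of "{..<m}" f] int unfolding prod by simp
    also have "\<dots> = (if k = l then 1 else 0)"
    proof (cases "k = l")
      case True
      have "(CLINT z|std_complex_normal. f i z) = 1" for i
        using True std_complex_normal_moments by (cases "i = l") (simp_all add: f_def S.prob_space[unfolded space_std_complex_normal])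
      then show ?thesis using True by simp
    next
      case False
      have "(CLINT z|std_complex_normal. f k z) = 0"
        using False std_complex_normal_moments by (simp add: f_def)
      then show ?thesis using False kl by (auto intro!: prod_zero)
    qed
    finally show "(CLINT \<zeta>|?P. \<zeta> k * cnj (\<zeta> l)) = (if k = l then 1 else 0)" .
  qed
  have cov: "(CLINT \<omega>|M. X i \<omega> * cnj (X j \<omega>)) = (\<Sum>k<m. A i k * cnj (A j k))"
    if ij: "i \<in> I" "j \<in> I" for i j
  proof -
    have "(CLINT \<omega>|M. X i \<omega> * cnj (X j \<omega>)) = (CLINT \<zeta>|?P. (\<Sum>k<m. A i k * \<zeta> k) * cnj (\<Sum>k<m. A j k * \<zeta> k))"
      using transfer[of "\<lambda>x. x i * cnj (x j)"] ij by simp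
    also have "\<dots> = (CLINT \<zeta>|?P. (\<Sum>k<m. \<Sum>l<m. (A i k * cnj (A j l)) * (\<zeta> k * cnj (\<zeta> l))))"
      by (simp add: sum_product mult_ac)
    also have "\<dots> = (\<Sum>k<m. \<Sum>l<m. (A i k * cnj (A j l)) * (CLINT \<zeta>|?P. \<zeta> k * cnj (\<zeta> l)))"
    proof -
      have int: "integrable ?P (\<lambda>\<zeta>. (A i k * cnj (A j l)) * (\<zeta> k * cnj (\<zeta> l)))" if "k \<in> {..<m}" "l \<in> {..<m}" for k l
        by (rule integrable_mult_right, rule cov_std(1)) (use that in auto)
      have "(CLINT \<zeta>|?P. (\<Sum>k<m. \<Sum>l<m. (A i k * cnj (A j l)) * (\<zeta> k * cnj (\<zeta> l)))) =
          (\<Sum>k<m. (CLINT \<zeta>|?P. (\<Sum>l<m. (A i k * cnj (A j l)) * (\<zeta> k * cnj (\<zeta> l)))))"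
        by (rule Bochner_Integration.integral_sum) (rule Bochner_Integration.integrable_sum, rule int)
      also have "\<dots> = (\<Sum>k<m. \<Sum>l<m. (CLINT \<zeta>|?P. (A i k * cnj (A j l)) * (\<zeta> k * cnj (\<zeta> l))))"
        by (rule sum.cong[OF refl], rule Bochner_Integration.integral_sum, rule int)
      finally show ?thesis by simp
    qed
    also have "\<dots> = (\<Sum>k<m. A i k * cnj (A j k))"
      by (intro sum.cong refl) (simp add: cov_std(2) if_distrib sum.delta cong: if_cong)
    finally show ?thesis .
  qed
  \<comment> \<open>The transpose of \<open>A\<close> applied to \<open>d\<close>: the functional
    pulled back to the independent coordinates, where the exponential factorises.\<close>
  define c where "c k = (\<Sum>i\<in>I. d i * A i k)" for k
  have "(CLINT \<omega>|M. iexp (Re (\<Sum>i\<in>I. d i * X i \<omega>))) =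
      (CLINT \<zeta>|?P. iexp (Re (\<Sum>i\<in>I. d i * (\<Sum>k<m. A i k * \<zeta> k))))"
    using transfer[of "\<lambda>x. iexp (Re (\<Sum>i\<in>I. d i * x i))"] by simp
  also have "\<dots> = (CLINT \<zeta>|?P. (\<Prod>k<m. iexp (Re (c k * \<zeta> k))))"
  proof (rule Bochner_Integration.integral_cong[OF refl])
    fix \<zeta> :: "nat \<Rightarrow> complex"
    have "(\<Sum>i\<in>I. d i * (\<Sum>k<m. A i k * \<zeta> k)) = (\<Sum>k<m. c k * \<zeta> k)"
      unfolding c_def sum_distrib_left sum_distrib_right by (subst sum.swap) (simp add: mult_ac)
    then show "iexp (Re (\<Sum>i\<in>I. d i * (\<Sum>k<m. A i k * \<zeta> k))) = (\<Prod>k<m. iexp (Re (c k * \<zeta> k)))"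
      by (simp only: exp_sum[OF finite_lessThan, symmetric] Re_sum of_real_sum sum_distrib_left)
  qed
  also have "\<dots> = (\<Prod>k<m. exp (- ((cmod (c k))\<^sup>2) / 4))"
  proof (subst P.product_integral_prod)
    have "(\<lambda>z. iexp (Re (c k * z))) \<in> borel_measurable borel" for k by measurable
    then have "(\<lambda>z. iexp (Re (c k * z))) \<in> borel_measurable std_complex_normal" for k
      unfolding measurable_cong_sets[OF sets_std_complex_normal refl] .
    then show "integrable std_complex_normal (\<lambda>z. iexp (Re (c k * z)))" for k
      by (intro S.integrable_const_bound[of _ 1]) (simp_all only: norm_exp_i_times, simp)
  qed (simp_all only: char_std_complex_normal finite_lessThan of_real_prod)
  also have "\<dots> = exp (- (\<Sum>k<m. c k * cnj (c k)) / 4)"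
  proof -
    have "complex_of_real (exp (- ((cmod z)\<^sup>2) / 4)) = exp (- (z * cnj z) / 4)" for z
      by (simp add: complex_norm_square[symmetric] flip: exp_of_real)
    then show ?thesis by (simp add: exp_sum sum_divide_distrib sum_negf[symmetric])
  qed
  also have "(\<Sum>k<m. c k * cnj (c k)) = (\<Sum>k<m. \<Sum>i\<in>I. \<Sum>j\<in>I. d i * cnj (d j) * (A i k * cnj (A j k)))"
    by (simp add: c_def sum_product mult_ac)
  also have "\<dots> = (\<Sum>i\<in>I. \<Sum>j\<in>I. \<Sum>k<m. d i * cnj (d j) * (A i k * cnj (A j k)))"
    by (subst sum.swap, intro sum.cong refl, rule sum.swap)
  also have "\<dots> = (\<Sum>i\<in>I. \<Sum>j\<in>I. d i * cnj (d j) * (CLINT \<omega>|M. X i \<omega> * cnj (X j \<omega>)))"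
    by (intro sum.cong refl) (simp add: cov sum_distrib_left)
  finally show ?thesis .
qed

section \<open>Invariance of the zero process\<close>

lemma distr_PiM_UNIV_eqI:
  fixes X :: "'i \<Rightarrow> 'a \<Rightarrow> 'c::topological_space" and Y :: "'i \<Rightarrow> 'b \<Rightarrow> 'c"
  assumes "prob_space M"
    and [measurable]: "\<And>i. X i \<in> borel_measurable M" "\<And>i. Y i \<in> borel_measurable N"
    and eq: "\<And>J. finite J \<Longrightarrow> distr M (PiM J (\<lambda>_. borel)) (\<lambda>x. \<lambda>j\<in>J. X j x) = distr N (PiM J (\<lambda>_. borel)) (\<lambda>x. \<lambda>j\<in>J. Y j x)"
  shows "distr M (PiM UNIV (\<lambda>_. borel)) (\<lambda>x i. X i x) = distr N (PiM UNIV (\<lambda>_. borel)) (\<lambda>x i. Y i x)"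
proof (rule measure_eqI_PiM_infinite[of _ UNIV "\<lambda>_. borel"])
  interpret prob_space M by fact
  have [measurable]: "(\<lambda>x i. X i x) \<in> measurable M (PiM UNIV (\<lambda>_. borel))"
    "(\<lambda>x i. Y i x) \<in> measurable N (PiM UNIV (\<lambda>_. borel))"
    by (rule measurable_abs_UNIV; measurable)+
  have [measurable]: "(\<lambda>x. \<lambda>j\<in>J. X j x) \<in> measurable M (PiM J (\<lambda>_. borel))"
    "(\<lambda>x. \<lambda>j\<in>J. Y j x) \<in> measurable N (PiM J (\<lambda>_. borel))" for J
    by measurable
  fix A and J :: "'i set" assume J: "finite J" and A: "\<And>i. i \<in> J \<Longrightarrow> A i \<in> sets (borel :: 'c measure)"
  have 1: "prod_emb UNIV (\<lambda>_. borel) J (Pi\<^sub>E J A) \<in> sets (PiM UNIV (\<lambda>_. borel :: 'c measure))"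
    using J A by (intro sets_PiM_I) auto
  have 2: "Pi\<^sub>E J A \<in> sets (PiM J (\<lambda>_. borel))"
    using J A by (intro sets_PiM_I_finite) auto
  have "emeasure (distr M (PiM UNIV (\<lambda>_. borel)) (\<lambda>x i. X i x)) (prod_emb UNIV (\<lambda>_. borel) J (Pi\<^sub>E J A)) =
      emeasure (distr M (PiM J (\<lambda>_. borel)) (\<lambda>x. \<lambda>j\<in>J. X j x)) (Pi\<^sub>E J A)"
    using 1 2 by (subst (1 2) emeasure_distr)
      (auto simp: prod_emb_def intro!: arg_cong2[where f=emeasure])
  also have "\<dots> = emeasure (distr N (PiM J (\<lambda>_. borel)) (\<lambda>x. \<lambda>j\<in>J. Y j x)) (Pi\<^sub>E J A)"
    by (simp only: eq[OF J])
  also have "\<dots> = emeasure (distr N (PiM UNIV (\<lambda>_. borel)) (\<lambda>x i. Y i x)) (prod_emb UNIV (\<lambda>_. borel) J (Pi\<^sub>E J A))"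
    using 1 2 by (subst (1 2) emeasure_distr)
      (auto simp: prod_emb_def intro!: arg_cong2[where f=emeasure])
  finally show "emeasure (distr M (PiM UNIV (\<lambda>_. borel)) (\<lambda>x i. X i x)) (prod_emb UNIV (\<lambda>_. borel) J (Pi\<^sub>E J A)) =
      emeasure (distr N (PiM UNIV (\<lambda>_. borel)) (\<lambda>x i. Y i x)) (prod_emb UNIV (\<lambda>_. borel) J (Pi\<^sub>E J A))" .
next
  interpret prob_space M by fact
  show "finite_measure (distr M (PiM UNIV (\<lambda>_. borel)) (\<lambda>x i. X i x))"
    by (intro finite_measure_distr measurable_abs_UNIV) measurable
qed simp_all

text \<open>The excess of the shifted kernel over the original one is
  \<open>\<alpha> * cnj \<beta> * u\<close>, the conjugate of the same term in \<open>v\<close>, and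
  |\<beta>|^2. Halving the last makes it a function of \<open>u\<close> plus its conjugate in
  \<open>v\<close>; this is minus that function. The parameter \<open>s\<close> stays outside so
  that exponents with different \<open>s\<close> can be added.\<close>

definition shift_exponent :: "complex \<Rightarrow> complex \<Rightarrow> complex \<Rightarrow> complex" where
  "shift_exponent \<alpha> \<beta> w = - (\<alpha> * cnj \<beta> * w + \<beta> * cnj \<beta> / 2)"

definition normalized_shift :: "complex \<Rightarrow> complex \<Rightarrow> real \<Rightarrow> (complex \<Rightarrow> complex) \<Rightarrow> complex \<Rightarrow> complex" where
  "normalized_shift \<alpha> \<beta> s f w = f (\<alpha> * w + \<beta>) * exp (s * shift_exponent \<alpha> \<beta> w)"

lemma normalized_shift_kernel:
  assumes "cmod \<alpha> = 1"
  shows "exp (s * shift_exponent \<alpha> \<beta> u) * cnj (exp (s * shift_exponent \<alpha> \<beta> v)) *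
      exp (s * (\<alpha> * u + \<beta>) * cnj (\<alpha> * v + \<beta>)) = exp (of_real s * u * cnj v)"
proof -
  have "\<alpha> * cnj \<alpha> = 1" using assms by (simp add: complex_norm_square[symmetric])
  \<comment> \<open>The relation |\<alpha>| = 1 in a form that rewrites inside longer
    products.\<close>
  then have a: "\<alpha> * (x * (cnj \<alpha> * y)) = x * y" for x y
    by (metis mult.assoc mult.commute mult.left_neutral)
  show ?thesis
    unfolding exp_cnj mult_exp_exp shift_exponent_def
    by (rule arg_cong[of _ _ exp]) (simp add: algebra_simps a)
qed

lemma measurable_normalized_shift [measurable]:
  "normalized_shift \<alpha> \<beta> s \<in> measurable (PiM UNIV (\<lambda>_. borel)) (PiM UNIV (\<lambda>_. borel))"
  unfolding normalized_shift_def by (intro measurable_abs_UNIV) measurable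

text \<open>A linear combination of values of the shifted function is one of values of
  \<open>g\<close> at the moved points, so the characteristic function formula is applied to
  \<open>g\<close> on both sides, and the kernel identity matches the covariances.\<close>

lemma normalized_shift_distr:
  assumes M: "prob_space M" and g: "gaussian_analytic_function M (\<lambda>x y. exp (of_real s * x * y)) g"
    and \<alpha>: "cmod \<alpha> = 1"
  shows "distr M (PiM UNIV (\<lambda>_. borel)) (\<lambda>\<omega>. normalized_shift \<alpha> \<beta> s (g \<omega>)) = distr M (PiM UNIV (\<lambda>_. borel)) g"
proof -
  have circ: "circular_gaussian_vector M S (\<lambda>z \<omega>. g \<omega> z)" if "finite S" for S
    using g that by (simp add: gaussian_analytic_function_def)
  have cov: "(CLINT \<omega>|M. g \<omega> u * cnj (g \<omega> v)) = exp (of_real s * u * cnj v)" for u v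
    using g by (simp add: gaussian_analytic_function_def)
  have meas [measurable]: "(\<lambda>\<omega>. g \<omega> z) \<in> borel_measurable M" for z
    using circ[of "{z}"] by (simp add: circular_gaussian_vector_def)
  define \<tau> where "\<tau> w = \<alpha> * w + \<beta>" for w
  define c where "c w = exp (s * shift_exponent \<alpha> \<beta> w)" for w
  have inj: "inj_on \<tau> A" for A using \<alpha> by (auto simp: inj_on_def \<tau>_def)
  have shift: "normalized_shift \<alpha> \<beta> s f w = f (\<tau> w) * c w" for f w
    by (simp add: normalized_shift_def \<tau>_def c_def)
  have kernel: "c u * cnj (c v) * exp (of_real s * \<tau> u * cnj (\<tau> v)) = exp (of_real s * u * cnj v)" for u v
    unfolding c_def \<tau>_def by (rule normalized_shift_kernel[OF \<alpha>])
  show ?thesis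
  proof (rule distr_PiM_UNIV_eqI[OF M, of "\<lambda>z \<omega>. normalized_shift \<alpha> \<beta> s (g \<omega>) z" "\<lambda>z \<omega>. g \<omega> z" M])
    fix J :: "complex set" assume J: "finite J"
    show "distr M (PiM J (\<lambda>_. borel)) (\<lambda>\<omega>. \<lambda>z\<in>J. normalized_shift \<alpha> \<beta> s (g \<omega>) z) =
        distr M (PiM J (\<lambda>_. borel)) (\<lambda>\<omega>. \<lambda>z\<in>J. g \<omega> z)"
    proof (rule distr_PiM_eq_of_char[OF M M J])
      fix d
      \<comment> \<open>Coefficients carried to the image points, with the exponential multiplier
        absorbed; the motion is injective because \<alpha> is nonzero.\<close>
      define d' where "d' u = d (the_inv_into J \<tau> u) * c (the_inv_into J \<tau> u)" for u
      have d': "d' (\<tau> z) = d z * c z" if "z \<in> J" for z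
        using that by (simp add: d'_def the_inv_into_f_f[OF inj])
      have "(\<Sum>z\<in>J. d z * normalized_shift \<alpha> \<beta> s (g \<omega>) z) = (\<Sum>u\<in>\<tau> ` J. d' u * g \<omega> u)" for \<omega>
        by (subst sum.reindex[OF inj]) (auto intro!: sum.cong simp: shift d')
      then have "(CLINT \<omega>|M. iexp (Re (\<Sum>z\<in>J. d z * normalized_shift \<alpha> \<beta> s (g \<omega>) z))) =
          (CLINT \<omega>|M. iexp (Re (\<Sum>u\<in>\<tau> ` J. d' u * g \<omega> u)))"
        by (simp only:)
      also have "\<dots> = exp (- (\<Sum>u\<in>\<tau> ` J. \<Sum>v\<in>\<tau> ` J. d' u * cnj (d' v) * exp (of_real s * u * cnj v)) / 4)"
        using circular_gaussian_vector_char[OF _ M circ, of "\<tau> ` J" d'] J by (simp only: cov finite_imageI)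
      also have "(\<Sum>u\<in>\<tau> ` J. \<Sum>v\<in>\<tau> ` J. d' u * cnj (d' v) * exp (of_real s * u * cnj v)) =
          (\<Sum>u\<in>J. \<Sum>v\<in>J. d u * cnj (d v) * exp (of_real s * u * cnj v))"
        unfolding sum.reindex[OF inj] o_def
        proof (intro sum.cong refl)
          fix u v assume uv: "u \<in> J" "v \<in> J"
          have "d' (\<tau> u) * cnj (d' (\<tau> v)) * exp (of_real s * \<tau> u * cnj (\<tau> v)) =
              d u * cnj (d v) * (c u * cnj (c v) * exp (of_real s * \<tau> u * cnj (\<tau> v)))"
            by (simp add: d' uv mult_ac)
          then show "d' (\<tau> u) * cnj (d' (\<tau> v)) * exp (of_real s * \<tau> u * cnj (\<tau> v)) =
              d u * cnj (d v) * exp (of_real s * u * cnj v)"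
            by (simp only: kernel)
        qed
      also have "exp (- \<dots> / 4) = (CLINT \<omega>|M. iexp (Re (\<Sum>z\<in>J. d z * g \<omega> z)))"
        using circular_gaussian_vector_char[OF J M circ[OF J], of d] by (simp only: cov)
      finally show "(CLINT \<omega>|M. iexp (Re (\<Sum>z\<in>J. d z * normalized_shift \<alpha> \<beta> s (g \<omega>) z))) =
          (CLINT \<omega>|M. iexp (Re (\<Sum>z\<in>J. d z * g \<omega> z)))" .
    qed (unfold shift, measurable)
  qed (unfold shift, measurable)
qed

section \<open>From independent components to zero processes\<close>

lemma joint_distr_map_eq:
  assumes "prob_space M" "I \<noteq> {}"
    and X: "prob_space.indep_vars M N X I"
    and T: "\<And>i. i \<in> I \<Longrightarrow> T i \<in> measurable (N i) (N i)"
    and eq: "\<And>i. i \<in> I \<Longrightarrow> distr M (N i) (\<lambda>\<omega>. T i (X i \<omega>)) = distr M (N i) (X i)"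
  shows "distr M (PiM I N) (\<lambda>\<omega>. \<lambda>i\<in>I. T i (X i \<omega>)) = distr M (PiM I N) (\<lambda>\<omega>. \<lambda>i\<in>I. X i \<omega>)"
proof -
  interpret prob_space M by fact
  have rv: "X i \<in> measurable M (N i)" if "i \<in> I" for i using X that by (auto simp: indep_vars_def)
  have rvT: "(\<lambda>\<omega>. T i (X i \<omega>)) \<in> measurable M (N i)" if "i \<in> I" for i
    using measurable_compose[OF rv[OF that] T[OF that]] .
  have "indep_vars N (\<lambda>i \<omega>. T i (X i \<omega>)) I" by (rule indep_vars_compose2[OF X T])
  then have "distr M (PiM I N) (\<lambda>\<omega>. \<lambda>i\<in>I. T i (X i \<omega>)) = PiM I (\<lambda>i. distr M (N i) (\<lambda>\<omega>. T i (X i \<omega>)))"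
    using indep_vars_iff_distr_eq_PiM'[OF \<open>I \<noteq> {}\<close>, where M'=N and X="\<lambda>i \<omega>. T i (X i \<omega>)"] rvT by simp
  also have "\<dots> = PiM I (\<lambda>i. distr M (N i) (X i))" by (intro PiM_cong refl eq)
  also have "\<dots> = distr M (PiM I N) (\<lambda>\<omega>. \<lambda>i\<in>I. X i \<omega>)"
    using indep_vars_iff_distr_eq_PiM'[OF \<open>I \<noteq> {}\<close>, where M'=N and X=X] rv X by simp
  finally show ?thesis .
qed

text \<open>Laws are compared on the full product sigma-algebra, but \<open>zero_measure\<close> is
  known to be measurable on \<open>entire_functions\<close>. Since all values are entire, a trace
  event has the same probability as any product event inducing it.\<close>

lemma eq_in_distribution_zero_process:
  assumes F: "F \<in> measurable M (PiM UNIV (\<lambda>_. borel))" "\<And>\<omega>. \<omega> \<in> space M \<Longrightarrow> F \<omega> holomorphic_on UNIV"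
    and G: "G \<in> measurable N (PiM UNIV (\<lambda>_. borel))" "\<And>\<omega>. \<omega> \<in> space N \<Longrightarrow> G \<omega> holomorphic_on UNIV"
    and eq: "distr M (PiM UNIV (\<lambda>_. borel)) F = distr N (PiM UNIV (\<lambda>_. borel)) G"
  shows "zero_process F \<in> measurable M random_measure_algebra"
    "distr M random_measure_algebra (zero_process F) = distr N random_measure_algebra (zero_process G)"
proof -
  have F': "F \<in> measurable M entire_functions" and G': "G \<in> measurable N entire_functions"
    unfolding entire_functions_def using F G by (auto intro!: measurable_restrict_space2)
  have zF: "zero_process F = (\<lambda>\<omega>. zero_measure (F \<omega>))" and zG: "zero_process G = (\<lambda>\<omega>. zero_measure (G \<omega>))"
    by (auto simp: zero_process_def)
  show "zero_process F \<in> measurable M random_measure_algebra"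
    unfolding zF by (rule measurable_compose[OF F' measurable_zero_measure])
  have "distr M entire_functions F = distr N entire_functions G"
  proof (rule measure_eqI)
    fix A assume "A \<in> sets (distr M entire_functions F)"
    then have A: "A \<in> sets entire_functions" by simp
    then obtain B where B: "B \<in> sets (PiM UNIV (\<lambda>_. borel))" "A = {f. f holomorphic_on UNIV} \<inter> B"
      by (auto simp: entire_functions_def sets_restrict_space)
    have "emeasure (distr M entire_functions F) A = emeasure (distr M (PiM UNIV (\<lambda>_. borel)) F) B"
      using A B F by (subst (1 2) emeasure_distr) (auto simp: F' intro!: arg_cong2[where f=emeasure])
    also have "\<dots> = emeasure (distr N entire_functions G) A"
      unfolding eq using A B G by (subst (1 2) emeasure_distr) (auto simp: G' intro!: arg_cong2[where f=emeasure])
    finally show "emeasure (distr M entire_functions F) A = emeasure (distr N entire_functions G) A" .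
  qed simp
  then show "distr M random_measure_algebra (zero_process F) = distr N random_measure_algebra (zero_process G)"
    unfolding zF zG using distr_distr[OF measurable_zero_measure F'] distr_distr[OF measurable_zero_measure G']
    by (simp add: o_def)
qed

lemma zero_measure_mult_exp:
  assumes f: "f holomorphic_on UNIV" and u: "u holomorphic_on UNIV"
  shows "zero_measure (\<lambda>w. f w * exp (u w)) = zero_measure f"
proof (cases "\<forall>w. f w = 0")
  case False
  then obtain a where a: "f a \<noteq> 0" by auto
  have e: "(\<lambda>w. exp (u w)) holomorphic_on UNIV" using u by (intro holomorphic_intros)
  have "multiplicity_at (\<lambda>w. f w * exp (u w)) w = multiplicity_at f w" for w
    using multiplicity_at_mult[OF f e a, of a w] multiplicity_at_nonzero[OF e, of w] by simp
  then have "emeasure (zero_measure (\<lambda>w. f w * exp (u w))) A = emeasure (zero_measure f) A"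
    if "A \<in> sets borel" for A
    using a that emeasure_zero_measure[OF f a that]
      emeasure_zero_measure[of "\<lambda>w. f w * exp (u w)" a A] holomorphic_on_mult[OF f e] by simp
  then show ?thesis by (intro measure_eqI) auto
qed (simp add: zero_measure_def)

text \<open>Common frame for product and determinant: \<Phi> builds the field from its independent
  components, and \<open>\<Phi>_shift\<close> is a weighted homogeneity by which the weights
  \<open>s i\<close> combine to a single exponent \<open>c\<close>.\<close>

lemma zero_process_shift_invariant:
  fixes X :: "'i \<Rightarrow> 'a \<Rightarrow> complex \<Rightarrow> complex" and \<Phi> :: "('i \<Rightarrow> complex \<Rightarrow> complex) \<Rightarrow> complex \<Rightarrow> complex"
  assumes M: "prob_space M" and I: "I \<noteq> {}" and \<alpha>: "cmod \<alpha> = 1"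
    and X: "\<And>i. i \<in> I \<Longrightarrow> gaussian_analytic_function M (\<lambda>x y. exp (of_real (s i) * x * y)) (X i)"
    and indep: "indep_random_functions M I X"
    and \<Phi>_meas: "\<Phi> \<in> measurable (PiM I (\<lambda>_. PiM UNIV (\<lambda>_. borel))) (PiM UNIV (\<lambda>_. borel))"
    and \<Phi>_hol: "\<And>f. (\<And>i. i \<in> I \<Longrightarrow> f i holomorphic_on UNIV) \<Longrightarrow> \<Phi> f holomorphic_on UNIV"
    and \<Phi>_shift: "\<And>f \<tau> e w. \<Phi> (\<lambda>i\<in>I. \<lambda>w. f i (\<tau> w) * exp (of_real (s i) * e w)) w =
      \<Phi> (\<lambda>i\<in>I. f i) (\<tau> w) * exp (of_real c * e w)"
    and F: "\<And>\<omega>. F \<omega> = \<Phi> (\<lambda>i\<in>I. X i \<omega>)"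
  shows "eq_in_distribution M random_measure_algebra (zero_process F) (zero_process (\<lambda>\<omega>. F \<omega> \<circ> (\<lambda>w. \<alpha> * w + \<beta>)))"
proof -
  let ?C = "PiM UNIV (\<lambda>_. borel) :: (complex \<Rightarrow> complex) measure"
  define T where "T i = normalized_shift \<alpha> \<beta> (s i)" for i
  \<comment> \<open>The intermediate field: it has the law of \<open>F\<close> because its
    components do, and the zeros of the moved \<open>F\<close> because it differs from that by an
    exponential factor.\<close>
  define F' where "F' \<omega> = \<Phi> (\<lambda>i\<in>I. T i (X i \<omega>))" for \<omega>
  have ind: "prob_space.indep_vars M (\<lambda>_. ?C) X I"
    using indep by (simp add: indep_random_functions_def)
  have rv: "X i \<in> measurable M ?C" if "i \<in> I" for i
    using ind that M by (simp add: prob_space.indep_vars_def)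
  have T: "T i \<in> measurable ?C ?C" for i unfolding T_def by measurable
  have mX: "(\<lambda>\<omega>. \<lambda>i\<in>I. X i \<omega>) \<in> measurable M (PiM I (\<lambda>_. ?C))"
    by (intro measurable_restrict rv)
  have mT: "(\<lambda>\<omega>. \<lambda>i\<in>I. T i (X i \<omega>)) \<in> measurable M (PiM I (\<lambda>_. ?C))"
    by (intro measurable_restrict measurable_compose[OF rv T])
  have law: "distr M (PiM I (\<lambda>_. ?C)) (\<lambda>\<omega>. \<lambda>i\<in>I. T i (X i \<omega>)) = distr M (PiM I (\<lambda>_. ?C)) (\<lambda>\<omega>. \<lambda>i\<in>I. X i \<omega>)"
    by (rule joint_distr_map_eq[OF M I ind T]) (unfold T_def, rule normalized_shift_distr[OF M X \<alpha>])
  have hol: "X i \<omega> holomorphic_on UNIV" if "i \<in> I" "\<omega> \<in> space M" for i \<omega>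
    using X[OF that(1)] that(2) by (simp add: gaussian_analytic_function_def)
  have hol_shift: "(\<lambda>w. f (\<alpha> * w + \<beta>)) holomorphic_on UNIV" if "f holomorphic_on UNIV" for f
    using holomorphic_on_compose_gen[OF _ that, of "\<lambda>w. \<alpha> * w + \<beta>" UNIV] by (simp add: o_def holomorphic_intros)
  have hol_exp: "(\<lambda>w. of_real s * shift_exponent \<alpha> \<beta> w) holomorphic_on UNIV" for s
    unfolding shift_exponent_def by (intro holomorphic_intros)
  have F_hol: "F \<omega> holomorphic_on UNIV" if "\<omega> \<in> space M" for \<omega>
    unfolding F using hol that by (intro \<Phi>_hol) simp
  have F'_eq: "F' \<omega> = (\<lambda>w. (F \<omega> \<circ> (\<lambda>w. \<alpha> * w + \<beta>)) w * exp (of_real c * shift_exponent \<alpha> \<beta> w))" for \<omega>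
    unfolding F'_def F T_def normalized_shift_def[abs_def] using \<Phi>_shift by (auto simp: fun_eq_iff)
  have F'_hol: "F' \<omega> holomorphic_on UNIV" if "\<omega> \<in> space M" for \<omega>
    unfolding F'_eq o_def
    by (rule holomorphic_on_mult[OF hol_shift[OF F_hol[OF that]] holomorphic_on_exp'[OF hol_exp]])
  have zero: "zero_process F' \<omega> = zero_process (\<lambda>\<omega>. F \<omega> \<circ> (\<lambda>w. \<alpha> * w + \<beta>)) \<omega>" if "\<omega> \<in> space M" for \<omega>
    unfolding zero_process_def F'_eq using hol_shift[OF F_hol[OF that]] hol_exp
    by (intro zero_measure_mult_exp) (auto simp: o_def)
  have mF: "F \<in> measurable M ?C" unfolding F[abs_def] by (rule measurable_compose[OF mX \<Phi>_meas])
  have mF': "F' \<in> measurable M ?C" unfolding F'_def[abs_def] by (rule measurable_compose[OF mT \<Phi>_meas])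
  have "distr M ?C F' = distr (distr M (PiM I (\<lambda>_. ?C)) (\<lambda>\<omega>. \<lambda>i\<in>I. T i (X i \<omega>))) ?C \<Phi>"
    unfolding distr_distr[OF \<Phi>_meas mT] by (simp add: F'_def[abs_def] o_def)
  also have "\<dots> = distr M ?C F"
    unfolding law distr_distr[OF \<Phi>_meas mX] by (simp add: F[abs_def] o_def)
  finally have eq: "distr M ?C F' = distr M ?C F" .
  have 1: "zero_process F \<in> measurable M random_measure_algebra"
    by (rule eq_in_distribution_zero_process(1)[OF mF F_hol mF F_hol refl])
  have 2: "zero_process F' \<in> measurable M random_measure_algebra"
    by (rule eq_in_distribution_zero_process(1)[OF mF' F'_hol mF F_hol eq])
  have 3: "distr M random_measure_algebra (zero_process F') = distr M random_measure_algebra (zero_process F)"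
    by (rule eq_in_distribution_zero_process(2)[OF mF' F'_hol mF F_hol eq])
  \<comment> \<open>Measurability for the moved field is inherited from \<open>F'\<close>, whose
    zero process coincides with it at every outcome.\<close>
  have 4: "zero_process (\<lambda>\<omega>. F \<omega> \<circ> (\<lambda>w. \<alpha> * w + \<beta>)) \<in> measurable M random_measure_algebra"
    by (rule measurable_cong[THEN iffD1, OF _ 2]) (rule zero)
  have "distr M random_measure_algebra (zero_process F') =
      distr M random_measure_algebra (zero_process (\<lambda>\<omega>. F \<omega> \<circ> (\<lambda>w. \<alpha> * w + \<beta>)))"
    by (rule distr_cong[OF refl refl zero])
  with 1 3 4 show ?thesis by (simp add: eq_in_distribution_def)
qed

section \<open>The product field and the determinant field\<close>

lemma measurable_product_space_eval:
  assumes "i \<in> I"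
  shows "(\<lambda>f. f i w) \<in> borel_measurable (PiM I (\<lambda>_. PiM UNIV (\<lambda>_. borel)))"
  using measurable_compose[OF measurable_component_singleton[OF assms] measurable_component_singleton[OF UNIV_I]] .

text \<open>The Leibniz formula makes the determinant a polynomial in the entries, so measurability,
  holomorphy and homogeneity can be checked term by term.\<close>

lemma det_mat_expand:
  "Determinant.det (Matrix.mat n n f) = (\<Sum>p | p permutes {0..<n}. signof p * (\<Prod>i=0..<n. f (i, p i)))"
proof -
  have "Matrix.mat n n f $$ (i, p i) = f (i, p i)" if "p permutes {0..<n}" "i \<in> {0..<n}" for p i
    using that permutes_in_image[OF that(1), of i] by simp
  then show ?thesis
    by (subst det_def'[OF mat_carrier]) (auto intro!: sum.cong prod.cong)
qed

lemma product_zero_process_shift_invariant: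
  fixes g :: "nat \<Rightarrow> 'a \<Rightarrow> complex \<Rightarrow> complex"
  assumes "J \<ge> 1" and M: "prob_space M"
    and g: "\<And>j. j \<in> {1..J} \<Longrightarrow> gaussian_analytic_function M (\<lambda>x y. exp (of_real (\<sigma> j) * x * y)) (g j)"
    and indep: "indep_random_functions M {1..J} g"
    and \<alpha>: "cmod \<alpha> = 1"
  shows "eq_in_distribution M random_measure_algebra (zero_process (product_field J g))
    (zero_process (\<lambda>\<omega>. product_field J g \<omega> \<circ> (\<lambda>w. \<alpha> * w + \<beta>)))"
proof (rule zero_process_shift_invariant[OF M _ \<alpha> g indep, where c = "\<Sum>j=1..J. \<sigma> j"
      and \<Phi> = "\<lambda>f w. \<Prod>j=1..J. f j w"])
  show "{1..J} \<noteq> {}" using assms(1) by simp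
  show "(\<lambda>(f :: nat \<Rightarrow> complex \<Rightarrow> complex) w. \<Prod>j=1..J. f j w) \<in> measurable (PiM {1..J} (\<lambda>_. PiM UNIV (\<lambda>_. borel))) (PiM UNIV (\<lambda>_. borel))"
    by (rule measurable_abs_UNIV, rule borel_measurable_prod, rule measurable_product_space_eval)
  show "(\<lambda>w. \<Prod>j=1..J. f j w) holomorphic_on UNIV"
    if "\<And>i. i \<in> {1..J} \<Longrightarrow> f i holomorphic_on UNIV" for f :: "nat \<Rightarrow> complex \<Rightarrow> complex"
    using that by (intro holomorphic_on_prod) auto
  show "(\<Prod>j=1..J. (\<lambda>i\<in>{1..J}. \<lambda>w. f i (\<tau> w) * exp (of_real (\<sigma> i) * e w)) j w) =
      (\<Prod>j=1..J. (\<lambda>i\<in>{1..J}. f i) j (\<tau> w)) * exp (of_real (\<Sum>j=1..J. \<sigma> j) * e w)" for f e \<tau> w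
    by (simp add: prod.distrib exp_sum sum_distrib_right)
  show "product_field J g \<omega> = (\<lambda>w. \<Prod>j=1..J. (\<lambda>i\<in>{1..J}. g i \<omega>) j w)" for \<omega>
    by (simp add: product_field_def fun_eq_iff)
qed

lemma det_zero_process_shift_invariant:
  fixes h :: "nat \<Rightarrow> nat \<Rightarrow> 'a \<Rightarrow> complex \<Rightarrow> complex"
  assumes "J \<ge> 1" and M: "prob_space M"
    and h: "\<And>i j. i \<in> {1..J} \<Longrightarrow> j \<in> {1..J} \<Longrightarrow>
      gaussian_analytic_function M (\<lambda>x y. exp (of_real ((\<sigma>p i + \<sigma>m j) / 2) * x * y)) (h i j)"
    and indep: "indep_random_functions M ({1..J} \<times> {1..J}) (\<lambda>(i, j). h i j)"
    and \<alpha>: "cmod \<alpha> = 1"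
  shows "eq_in_distribution M random_measure_algebra (zero_process (det_field J h))
    (zero_process (\<lambda>\<omega>. det_field J h \<omega> \<circ> (\<lambda>w. \<alpha> * w + \<beta>)))"
proof -
  let ?I = "{1..J} \<times> {1..J}"
  \<comment> \<open>The exponent of the diagonal term of the Leibniz expansion. Permutations act on
    \<open>{0..<J}\<close> and the fields are indexed from 1, hence \<open>Suc\<close>.\<close>
  define c where "c = (\<Sum>i=0..<J. (\<sigma>p (Suc i) + \<sigma>m (Suc i)) / 2)"
  define \<Phi> where "\<Phi> f w = (\<Sum>p | p permutes {0..<J}. signof p * (\<Prod>i=0..<J. f (Suc i, Suc (p i)) w))"
    for f :: "nat \<times> nat \<Rightarrow> complex \<Rightarrow> complex" and w
  have in_I: "(Suc i, Suc (p i)) \<in> ?I" if "p permutes {0..<J}" "i \<in> {0..<J}" for p i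
  proof -
    have "p i < J" using that permutes_in_image[OF that(1), of i] by simp
    then show ?thesis using that(2) by (simp add: Suc_le_eq)
  qed
  show ?thesis
  proof (rule zero_process_shift_invariant[OF M _ \<alpha> _ indep, where c = c and \<Phi> = \<Phi>
        and s = "\<lambda>(i, j). (\<sigma>p i + \<sigma>m j) / 2"])
    show "?I \<noteq> {}" using assms(1) by simp
    show "gaussian_analytic_function M (\<lambda>x y. exp (of_real (case k of (i, j) \<Rightarrow> (\<sigma>p i + \<sigma>m j) / 2) * x * y))
        (case k of (i, j) \<Rightarrow> h i j)" if "k \<in> ?I" for k
      using that h by (cases k) simp
    show "\<Phi> \<in> measurable (PiM ?I (\<lambda>_. PiM UNIV (\<lambda>_. borel))) (PiM UNIV (\<lambda>_. borel))"
      unfolding \<Phi>_def[abs_def]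
      by (intro measurable_abs_UNIV borel_measurable_sum borel_measurable_times borel_measurable_const
          borel_measurable_prod measurable_product_space_eval in_I) auto
    show "\<Phi> f holomorphic_on UNIV" if "\<And>i. i \<in> ?I \<Longrightarrow> f i holomorphic_on UNIV" for f
      unfolding \<Phi>_def[abs_def]
      by (intro holomorphic_on_sum holomorphic_on_mult holomorphic_on_const holomorphic_on_prod that in_I) auto
    show "\<Phi> (\<lambda>k\<in>?I. \<lambda>w. f k (\<tau> w) * exp (of_real (case k of (i, j) \<Rightarrow> (\<sigma>p i + \<sigma>m j) / 2) * e w)) w =
        \<Phi> (\<lambda>k\<in>?I. f k) (\<tau> w) * exp (of_real c * e w)" for f \<tau> e w
      unfolding \<Phi>_def sum_distrib_right
    proof (rule sum.cong[OF refl])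
      fix p assume "p \<in> {p. p permutes {0..<J}}"
      then have p: "p permutes {0..<J}" by simp
      \<comment> \<open>Every permutation meets each column once, so the column weights have the
        same sum in every Leibniz term; all terms then carry the common exponent
        \<open>c\<close>.\<close>
      have "(\<Sum>i=0..<J. \<sigma>m (Suc (p i))) = (\<Sum>i=0..<J. \<sigma>m (Suc i))"
        using sum.permute[OF p, of "\<lambda>i. \<sigma>m (Suc i)"] by (simp add: o_def)
      then have c: "c = (\<Sum>i=0..<J. (\<sigma>p (Suc i) + \<sigma>m (Suc (p i))) / 2)"
        by (simp add: c_def sum.distrib flip: sum_divide_distrib)
      have "(\<Prod>i=0..<J. (\<lambda>k\<in>?I. \<lambda>w. f k (\<tau> w) * exp (of_real (case k of (i, j) \<Rightarrow> (\<sigma>p i + \<sigma>m j) / 2) * e w))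
            (Suc i, Suc (p i)) w) =
          (\<Prod>i=0..<J. (\<lambda>k\<in>?I. f k) (Suc i, Suc (p i)) (\<tau> w) *
            exp (of_real ((\<sigma>p (Suc i) + \<sigma>m (Suc (p i))) / 2) * e w))"
        by (intro prod.cong refl) (simp only: restrict_apply in_I[OF p] if_True prod.case)
      also have "\<dots> = (\<Prod>i=0..<J. (\<lambda>k\<in>?I. f k) (Suc i, Suc (p i)) (\<tau> w)) * exp (of_real c * e w)"
        unfolding prod.distrib c of_real_sum sum_distrib_right by (simp only: exp_sum finite_atLeastLessThan)
      finally show "signof p * (\<Prod>i=0..<J. (\<lambda>k\<in>?I. \<lambda>w. f k (\<tau> w) *
            exp (of_real (case k of (i, j) \<Rightarrow> (\<sigma>p i + \<sigma>m j) / 2) * e w)) (Suc i, Suc (p i)) w) =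
          signof p * (\<Prod>i=0..<J. (\<lambda>k\<in>?I. f k) (Suc i, Suc (p i)) (\<tau> w)) * exp (of_real c * e w)"
        by (simp only: mult.assoc)
    qed
    show "det_field J h \<omega> = \<Phi> (\<lambda>k\<in>?I. (case k of (i, j) \<Rightarrow> h i j) \<omega>)" for \<omega>
    proof
      fix w
      show "det_field J h \<omega> w = \<Phi> (\<lambda>k\<in>?I. (case k of (i, j) \<Rightarrow> h i j) \<omega>) w"
        unfolding det_field_def \<Phi>_def det_mat_expand
        by (intro sum.cong refl arg_cong2[of _ _ _ _ "(*)"] prod.cong)
          (simp only: mem_Collect_eq restrict_apply in_I if_True prod.case)
    qed
  qed
qed

theorem proposition13:
  fixes J :: nat
    and \<sigma>p \<sigma>m :: "nat \<Rightarrow> real"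
    and M :: "'a measure" and g :: "nat \<Rightarrow> 'a \<Rightarrow> complex \<Rightarrow> complex"
    and M' :: "'b measure" and h :: "nat \<Rightarrow> nat \<Rightarrow> 'b \<Rightarrow> complex \<Rightarrow> complex"
    and \<alpha> \<beta> :: complex
  assumes "J \<ge> 1"
    and "\<And>j. j \<in> {1..J} \<Longrightarrow> \<sigma>p j > 0"
    and "\<And>j. j \<in> {1..J} \<Longrightarrow> \<sigma>m j > 0"
    and "prob_space M"
    and "\<And>j. j \<in> {1..J} \<Longrightarrow>
           gaussian_analytic_function M (\<lambda>x y. exp (of_real (\<sigma>p j) * x * y)) (g j)"
    and "indep_random_functions M {1..J} g"
    and "prob_space M'"
    and "\<And>i j. i \<in> {1..J} \<Longrightarrow> j \<in> {1..J} \<Longrightarrow>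
           gaussian_analytic_function M'
             (\<lambda>x y. exp (of_real ((\<sigma>p i + \<sigma>m j) / 2) * x * y)) (h i j)"
    and "indep_random_functions M' ({1..J} \<times> {1..J}) (\<lambda>(i, j). h i j)"
    and "cmod \<alpha> = 1"
  shows "let \<tau> = (\<lambda>w. \<alpha> * w + \<beta>);
             G = product_field J g;
             G' = det_field J h
         in eq_in_distribution M random_measure_algebra
              (zero_process G) (zero_process (\<lambda>\<omega>. G \<omega> \<circ> \<tau>))
          \<and> eq_in_distribution M' random_measure_algebra
              (zero_process G') (zero_process (\<lambda>\<omega>. G' \<omega> \<circ> \<tau>))"
  unfolding Let_def
  using product_zero_process_shift_invariant[OF assms(1,4,5,6,10)]
    det_zero_process_shift_invariant[OF assms(1,7,8,9,10)] by blast

end
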